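(* There exists a distribution $\mathcal{D}^*$ over $[N]$ with the following property: any algorithm which, given access to the \textsc{Samp} and \textsc{Pcond} oracles of an unknown distribution $\mathcal{D}$ over $[N]$, outputs ACCEPT with probability at least $2/3$ if $\mathcal{D}=\mathcal{D}^*$ and outputs REJECT with probability at least $2/3$ if $d_{\mathrm{TV}}(\mathcal{D},\mathcal{D}^* )\ge\varepsilon$, must make at least $\Omega\!\left(\sqrt{\frac{\log N}{\log(\varepsilon^{-1}\log N)}}\cdot\varepsilon^{-2}\right)$ queries.
   Context: For a distribution $\mathcal{D}$ over $[N]$ write $D(i)=\Pr_{x\sim\mathcal{D}}(x=i)$. \textsc{Samp} returns an independent sample from $\mathcal{D}$; \textsc{Pcond}$(x,y)$ for distinct $x,y\in[N]$ returns $x$ with probability $\frac{D(x)}{D(x)+D(y)}$ and $y$ otherwise. $d_{\mathrm{TV}}(\mathcal{D}_1,\mathcal{D}_2)=\frac12\sum_i|D_1(i)-D_2(i)|$. *)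

theory Defs
  imports "HOL-Probability.Probability"
begin

text \<open>Distributions over \<open>[N] = {1..N}\<close> are probability mass functions on the natural numbers
  whose support lies in \<open>{1..N}\<close>.\<close>

definition distribution_on :: "nat \<Rightarrow> nat pmf \<Rightarrow> bool" where
  "distribution_on N D \<longleftrightarrow> set_pmf D \<subseteq> {1..N}"

definition tv_dist :: "nat \<Rightarrow> nat pmf \<Rightarrow> nat pmf \<Rightarrow> real" where
  "tv_dist N D1 D2 = 1 / 2 * (\<Sum>i\<in>{1..N}. \<bar>pmf D1 i - pmf D2 i\<bar>)"

text \<open>If \<open>D x = D y = 0\<close>, the quotient \<open>D x / (D x + D y)\<close> is undefined. The answer of the oracle
  in this case is an explicit parameter \<open>null\<close>; it covers both the uniform choice from
  \<open>{x, y}\<close> and a failure symbol (encoded as a number outside \<open>[N]\<close>).\<close>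

definition pcond_oracle :: "(nat \<Rightarrow> nat \<Rightarrow> nat pmf) \<Rightarrow> nat pmf \<Rightarrow> nat \<Rightarrow> nat \<Rightarrow> nat pmf" where
  "pcond_oracle null D x y =
     (if pmf D x + pmf D y = 0 then null x y
      else map_pmf (\<lambda>b. if b then x else y) (bernoulli_pmf (pmf D x / (pmf D x + pmf D y))))"

datatype verdict = ACCEPT | REJECT

text \<open>Adaptive randomized algorithms as decision trees: the argument of a continuation is the answer
  of the oracle, or the outcome of the internal coin, which has an arbitrary distribution on
  the natural numbers. The unknown distribution is reachable only through the two oracles.\<close>

datatype algorithm =
    Output verdict
  | Coin "nat pmf" "nat \<Rightarrow> algorithm"
  | Samp "nat \<Rightarrow> algorithm"
  | Pcond nat nat "nat \<Rightarrow> algorithm"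

primrec run :: "(nat \<Rightarrow> nat \<Rightarrow> nat pmf) \<Rightarrow> nat pmf \<Rightarrow> algorithm \<Rightarrow> verdict pmf" where
  "run null D (Output v) = return_pmf v"
| "run null D (Coin p k) = bind_pmf p (\<lambda>w. run null D (k w))"
| "run null D (Samp k) = bind_pmf D (\<lambda>z. run null D (k z))"
| "run null D (Pcond x y k) = bind_pmf (pcond_oracle null D x y) (\<lambda>z. run null D (k z))"

text \<open>\<open>query_bounded N q A\<close>: on every run, \<open>A\<close> makes at most \<open>q\<close> oracle queries (internal coins are
  free), and every \<open>Pcond\<close> query is for two distinct elements of \<open>[N]\<close>.
  After \<open>Pcond\<close>, all answers are considered since \<open>null\<close> is unrestricted.\<close>

inductive query_bounded :: "nat \<Rightarrow> nat \<Rightarrow> algorithm \<Rightarrow> bool" for N :: nat where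
  Output: "query_bounded N q (Output v)"
| Coin: "(\<And>w. w \<in> set_pmf p \<Longrightarrow> query_bounded N q (k w)) \<Longrightarrow> query_bounded N q (Coin p k)"
| Samp: "(\<And>z. z \<in> {1..N} \<Longrightarrow> query_bounded N q (k z)) \<Longrightarrow> query_bounded N (Suc q) (Samp k)"
| Pcond: "x \<in> {1..N} \<Longrightarrow> y \<in> {1..N} \<Longrightarrow> x \<noteq> y \<Longrightarrow> (\<And>z. query_bounded N q (k z)) \<Longrightarrow>
    query_bounded N (Suc q) (Pcond x y k)"

definition identity_tester ::
  "(nat \<Rightarrow> nat \<Rightarrow> nat pmf) \<Rightarrow> nat \<Rightarrow> nat pmf \<Rightarrow> real \<Rightarrow> algorithm \<Rightarrow> bool" where
  "identity_tester null N Dstar \<epsilon> A \<longleftrightarrow>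
     pmf (run null Dstar A) ACCEPT \<ge> 2 / 3 \<and>
     (\<forall>D. distribution_on N D \<longrightarrow> tv_dist N D Dstar \<ge> \<epsilon> \<longrightarrow> pmf (run null D A) REJECT \<ge> 2 / 3)"

end

(* The reference distribution spreads its mass evenly over n = r m buckets whose sizes grow
   geometrically with ratio K. The alternatives are indexed by a choice of one bucket in each of the
   r groups of m buckets: the chosen bucket becomes heavier and the others of its group lighter by
   the same total amount, at relative scale delta ~ epsilon. A Pcond query inside a bucket is a fair
   coin, and one across buckets returns the element of the smaller bucket except with probability
   O(1/K), so for K ~ log N / epsilon^2 the algorithm learns from its samples only. Over q samples
   the second moment of the likelihood ratio of the uniform mixture of alternatives is at most
   exp (O(q^2 epsilon^4 / r)) (Ingster's method), whence q = Omega(sqrt r / epsilon^2) with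
   r ~ log N / log K. Adaptivity is absorbed by an induction on the decision tree for arbitrary
   signed combinations of the alternatives. *)
theory Submission
  imports Defs "HOL-Real_Asymp.Real_Asymp"
begin

section \<open>Signed mixtures of decision tree runs\<close>

text \<open>Once \<open>Pcond\<close> is silenced, a sample reveals only its bucket. What remains is
  uniformity testing on r m points, with its classical bound of order sqrt (r m) / epsilon^2; m is
  fixed by \<open>\<epsilon>\<^sub>0\<close>, so r carries the growth. The ratio K is a compromise:
  the errors of the \<open>Pcond\<close> answers add up over the q queries, so K must be at least of
  the order of the bound to be proved, while \<open>K ^ (r * m) \<le> N\<close> limits r to about
  log N / log K. Taking log N / epsilon^2 is generous, but costs only a constant factor in log K.
  The induction over the tree tracks two norms of the coefficients. Samples are paid for by an L2
  norm, which grows with the number of samples. Errors of \<open>Pcond\<close> answers are charged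
  to the L1 norm, which a sample preserves on average.\<close>

definition overlap :: "nat \<Rightarrow> nat pmf \<Rightarrow> nat pmf \<Rightarrow> nat pmf \<Rightarrow> real" where
  "overlap N D0 D1 D2 = (\<Sum>z\<in>{1..N}. pmf D1 z * pmf D2 z / pmf D0 z)"

text \<open>With \<open>M s t = overlap N D0 (D s) (D t)\<close>, this is the squared norm in \<open>L\<^sup>2(D0)\<close>, taken over
  \<open>q\<close> independent samples, of the density of the signed measure \<open>\<Sum>\<^sub>s c s D s\<^sup>q\<close>.\<close>

definition gram :: "'s set \<Rightarrow> ('s \<Rightarrow> 's \<Rightarrow> real) \<Rightarrow> ('s \<Rightarrow> real) \<Rightarrow> nat \<Rightarrow> real" where
  "gram I M c q = (\<Sum>s\<in>I. \<Sum>t\<in>I. c s * c t * M s t ^ q)"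

section \<open>Recursion and monotonicity of the second moment\<close>

lemma gram_0: "gram I M c 0 = (\<Sum>s\<in>I. c s)\<^sup>2"
  by (simp add: gram_def power2_eq_square sum_product)

lemma sum_pmf_distribution_on:
  assumes "distribution_on N D"
  shows "(\<Sum>z\<in>{1..N}. pmf D z) = 1"
  using assms by (intro sum_pmf_eq_1) (auto simp: distribution_on_def)

lemma expectation_distribution_on:
  fixes f :: "nat \<Rightarrow> real"
  assumes "distribution_on N D"
  shows "measure_pmf.expectation D f = (\<Sum>z\<in>{1..N}. pmf D z * f z)"
  using assms
  by (subst integral_measure_pmf_real[of "{1..N}"])
     (auto simp: distribution_on_def mult.commute)

text \<open>Revealing the value \<open>z\<close> of one sample multiplies each coefficient by the
  likelihood ratio of \<open>z\<close>, and averaging the product of two such ratios under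
  \<open>D0\<close> gives back one factor \<open>overlap\<close>. A \<open>Samp\<close> node follows
  this recursion.\<close>

lemma gram_Suc:
  assumes ac: "\<And>s z. s \<in> I \<Longrightarrow> pmf D0 z = 0 \<Longrightarrow> pmf (D s) z = 0"
  shows "gram I (\<lambda>s t. overlap N D0 (D s) (D t)) c (Suc q) =
    (\<Sum>z\<in>{1..N}. pmf D0 z *
       gram I (\<lambda>s t. overlap N D0 (D s) (D t)) (\<lambda>s. c s * (pmf (D s) z / pmf D0 z)) q)"
proof -
  let ?M = "\<lambda>s t. overlap N D0 (D s) (D t)"
  have "(\<Sum>z\<in>{1..N}. pmf D0 z * gram I ?M (\<lambda>s. c s * (pmf (D s) z / pmf D0 z)) q) =
    (\<Sum>z\<in>{1..N}. \<Sum>s\<in>I. \<Sum>t\<in>I. c s * c t * ?M s t ^ q * (pmf (D s) z * pmf (D t) z / pmf D0 z))"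
    unfolding gram_def sum_distrib_left
    by (intro sum.cong refl) (simp add: field_simps)
  also have "\<dots> = (\<Sum>s\<in>I. \<Sum>t\<in>I. \<Sum>z\<in>{1..N}. c s * c t * ?M s t ^ q * (pmf (D s) z * pmf (D t) z / pmf D0 z))"
    by (subst sum.swap, rule sum.cong[OF refl], rule sum.swap)
  also have "\<dots> = gram I ?M c (Suc q)"
    unfolding gram_def
    by (intro sum.cong refl) (simp only: sum_distrib_left[symmetric] overlap_def[symmetric], simp)
  finally show ?thesis by simp
qed

text \<open>Jensen's inequality for the square, obtained from Cauchy-Schwarz by splitting each
  weight into two square roots.\<close>

lemma sum_weighted_square_le:
  fixes w f :: "'a \<Rightarrow> real"
  assumes "\<And>z. z \<in> Z \<Longrightarrow> 0 \<le> w z" "sum w Z = 1"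
  shows "(\<Sum>z\<in>Z. w z * f z)\<^sup>2 \<le> (\<Sum>z\<in>Z. w z * (f z)\<^sup>2)"
proof -
  have "(\<Sum>z\<in>Z. sqrt (w z) * (sqrt (w z) * f z))\<^sup>2
      \<le> (\<Sum>z\<in>Z. (sqrt (w z))\<^sup>2) * (\<Sum>z\<in>Z. (sqrt (w z) * f z)\<^sup>2)"
    by (rule Cauchy_Schwarz_ineq_sum)
  moreover have "(\<Sum>z\<in>Z. sqrt (w z) * (sqrt (w z) * f z)) = (\<Sum>z\<in>Z. w z * f z)"
    using assms(1) by (intro sum.cong refl) (simp flip: mult.assoc)
  moreover have "(\<Sum>z\<in>Z. (sqrt (w z))\<^sup>2) = 1"
    using assms by (simp cong: sum.cong)
  moreover have "(\<Sum>z\<in>Z. (sqrt (w z) * f z)\<^sup>2) = (\<Sum>z\<in>Z. w z * (f z)\<^sup>2)"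
    using assms(1) by (intro sum.cong refl) (simp add: power_mult_distrib)
  ultimately show ?thesis by simp
qed

text \<open>Dropping a sample is a conditional expectation, which contracts the L2 norm. Only the
  base case needs an inequality (Jensen); the recursion carries it upwards. It lets a
  \<open>Pcond\<close> node spend a query without taking a sample.\<close>

lemma gram_mono_Suc:
  assumes D0: "distribution_on N D0"
    and D: "\<And>s. s \<in> I \<Longrightarrow> distribution_on N (D s)"
    and ac: "\<And>s z. s \<in> I \<Longrightarrow> pmf D0 z = 0 \<Longrightarrow> pmf (D s) z = 0"
  shows "gram I (\<lambda>s t. overlap N D0 (D s) (D t)) c q
    \<le> gram I (\<lambda>s t. overlap N D0 (D s) (D t)) c (Suc q)"
proof -
  let ?G = "gram I (\<lambda>s t. overlap N D0 (D s) (D t))"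
  have step: "?G c (Suc q) = (\<Sum>z\<in>{1..N}. pmf D0 z * ?G (\<lambda>s. c s * (pmf (D s) z / pmf D0 z)) q)" for c q
    by (rule gram_Suc) (rule ac)
  show ?thesis
  proof (induction q arbitrary: c)
    case 0
    have "(\<Sum>s\<in>I. c s) = (\<Sum>s\<in>I. c s * (\<Sum>z\<in>{1..N}. pmf (D s) z))"
      using sum_pmf_distribution_on[OF D] by (intro sum.cong refl) simp
    also have "\<dots> = (\<Sum>z\<in>{1..N}. \<Sum>s\<in>I. c s * pmf (D s) z)"
      by (simp only: sum_distrib_left, rule sum.swap)
    also have "\<dots> = (\<Sum>z\<in>{1..N}. pmf D0 z * (\<Sum>s\<in>I. c s * (pmf (D s) z / pmf D0 z)))"
      unfolding sum_distrib_left using ac by (intro sum.cong refl) auto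
    finally have eq: "(\<Sum>s\<in>I. c s) = \<dots>" .
    show ?case
      unfolding step gram_0 eq
      by (rule sum_weighted_square_le) (use sum_pmf_distribution_on[OF D0] in auto)
  next
    case (Suc q)
    show ?case
      unfolding step[of c q] step[of c "Suc q"]
      by (intro sum_mono mult_left_mono Suc.IH) auto
  qed
qed

text \<open>The square of the sum is \<open>gram\<close> without samples, so monotonicity applies.
  The first bound settles the leaves of the tree; the second allows a root of \<open>gram\<close> to
  be squared back.\<close>

lemma gram_bounds:
  assumes "distribution_on N D0"
    and "\<And>s. s \<in> I \<Longrightarrow> distribution_on N (D s)"
    and "\<And>s z. s \<in> I \<Longrightarrow> pmf D0 z = 0 \<Longrightarrow> pmf (D s) z = 0"
  shows "(\<Sum>s\<in>I. c s)\<^sup>2 \<le> gram I (\<lambda>s t. overlap N D0 (D s) (D t)) c q"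
    and "0 \<le> gram I (\<lambda>s t. overlap N D0 (D s) (D t)) c q"
proof -
  show *: "(\<Sum>s\<in>I. c s)\<^sup>2 \<le> gram I (\<lambda>s t. overlap N D0 (D s) (D t)) c q"
    unfolding gram_0[symmetric, where M = "\<lambda>s t. overlap N D0 (D s) (D t)"]
    by (rule lift_Suc_mono_le[of "gram I (\<lambda>s t. overlap N D0 (D s) (D t)) c"])
       (use gram_mono_Suc[where D = D, OF assms] in auto)
  show "0 \<le> gram I (\<lambda>s t. overlap N D0 (D s) (D t)) c q"
    using * zero_le_power2 order_trans by blast
qed

text \<open>A single simulated answer \<open>O'\<close> serves all of \<open>\<E>\<close>, within
  total variation distance \<open>e\<close>. Test functions express the distance because they will
  be instantiated with the probability that the continuation ends in a given verdict, as a function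
  of the answer.\<close>

definition uninformative ::
  "(nat \<Rightarrow> nat \<Rightarrow> nat pmf) \<Rightarrow> nat pmf set \<Rightarrow> real \<Rightarrow> nat \<Rightarrow> nat \<Rightarrow> bool" where
  "uninformative null \<E> e x y \<longleftrightarrow>
    (\<exists>O'. \<forall>E\<in>\<E>. \<forall>f::nat \<Rightarrow> real. (\<forall>z. 0 \<le> f z \<and> f z \<le> 1) \<longrightarrow>
       \<bar>measure_pmf.expectation (pcond_oracle null E x y) f - measure_pmf.expectation O' f\<bar> \<le> e)"

text \<open>A sample moves \<open>gram\<close> one level up; simulating the answer of a
  \<open>Pcond\<close> query costs \<open>\<bar>c s\<bar> * e\<close> for each \<open>s\<close>. A
  \<open>Pcond\<close> query that is distributed as a fresh sample is treated as a
  \<open>Samp\<close> node.\<close>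

lemma distinguishing_bound:
  fixes D :: "'s \<Rightarrow> nat pmf"
  assumes D0: "distribution_on N D0"
    and D: "\<And>s. s \<in> I \<Longrightarrow> distribution_on N (D s)"
    and ac: "\<And>s z. s \<in> I \<Longrightarrow> pmf D0 z = 0 \<Longrightarrow> pmf (D s) z = 0"
    and e: "0 \<le> e"
    and pc: "\<And>x y. x \<in> {1..N} \<Longrightarrow> y \<in> {1..N} \<Longrightarrow> x \<noteq> y \<Longrightarrow>
      uninformative null (D ` I) e x y \<or> (\<forall>E\<in>D ` I. pcond_oracle null E x y = E)"
    and A: "query_bounded N q A"
  shows "\<bar>\<Sum>s\<in>I. c s * pmf (run null (D s) A) v\<bar>
    \<le> sqrt (gram I (\<lambda>s t. overlap N D0 (D s) (D t)) c q) + real q * e * (\<Sum>s\<in>I. \<bar>c s\<bar>)"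
  using A
proof (induction arbitrary: c rule: query_bounded.induct)
  let ?M = "\<lambda>s t. overlap N D0 (D s) (D t)"
  let ?B = "\<lambda>c q. sqrt (gram I ?M c q) + real q * e * (\<Sum>s\<in>I. \<bar>c s\<bar>)"
  \<comment> \<open>Randomness shared by all \<open>s\<close> acts as a coin: a bound valid for
    every outcome survives averaging. Simulated \<open>Pcond\<close> answers are handled in this way
    too.\<close>
  have common: "\<bar>\<Sum>s\<in>I. c s * measure_pmf.expectation p (g s)\<bar> \<le> b"
    if g: "\<And>s z. 0 \<le> g s z \<and> g s z \<le> 1"
      and le: "\<And>z. z \<in> set_pmf p \<Longrightarrow> \<bar>\<Sum>s\<in>I. c s * g s z\<bar> \<le> b"
    for p :: "nat pmf" and g :: "'s \<Rightarrow> nat \<Rightarrow> real" and c b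
  proof -
    have int: "integrable (measure_pmf p) (g s)" for s
      by (rule measure_pmf.integrable_const_bound[where B = 1]) (use g in \<open>auto simp: abs_of_nonneg\<close>)
    have b: "0 \<le> b"
      using le set_pmf_not_empty[of p] by fastforce
    have "(\<Sum>s\<in>I. c s * measure_pmf.expectation p (g s)) = measure_pmf.expectation p (\<lambda>z. \<Sum>s\<in>I. c s * g s z)"
      by (subst Bochner_Integration.integral_sum) (auto intro: int)
    also have "\<bar>\<dots>\<bar> \<le> measure_pmf.expectation p (\<lambda>z. \<bar>\<Sum>s\<in>I. c s * g s z\<bar>)"
      by (rule integral_abs_bound)
    also have "\<dots> \<le> b"
      by (rule measure_pmf.integral_le_const)
         (auto simp: AE_measure_pmf_iff intro!: le int integrable_abs Bochner_Integration.integrable_sum)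
    finally show ?thesis .
  qed
  have mono: "?B c q \<le> ?B c (Suc q)" for c q
    using gram_mono_Suc[where D = D, OF D0 D ac, of I c q] e
    by (intro add_mono mult_right_mono) (auto intro!: sum_nonneg)
  have samp: "\<bar>\<Sum>s\<in>I. c s * pmf (bind_pmf (D s) (\<lambda>z. run null (D s) (k z))) v\<bar> \<le> ?B c (Suc q)"
    if IH: "\<And>z c. z \<in> {1..N} \<Longrightarrow> \<bar>\<Sum>s\<in>I. c s * pmf (run null (D s) (k z)) v\<bar> \<le> ?B c q"
    for k q c
  proof -
    \<comment> \<open>The coefficients that the subtree below the answer \<open>z\<close> sees.
      Where \<open>D0\<close> vanishes the quotient is 0 by default, in agreement with
      \<open>ac\<close>.\<close>
    define c' where "c' z s = c s * (pmf (D s) z / pmf D0 z)" for z s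
    have "(\<Sum>s\<in>I. c s * pmf (bind_pmf (D s) (\<lambda>z. run null (D s) (k z))) v)
       = (\<Sum>s\<in>I. \<Sum>z\<in>{1..N}. c s * pmf (D s) z * pmf (run null (D s) (k z)) v)"
      by (intro sum.cong refl)
         (simp add: pmf_bind expectation_distribution_on[OF D] sum_distrib_left mult.assoc)
    also have "\<dots> = (\<Sum>z\<in>{1..N}. \<Sum>s\<in>I. c s * pmf (D s) z * pmf (run null (D s) (k z)) v)"
      by (rule sum.swap)
    also have "\<dots> = (\<Sum>z\<in>{1..N}. pmf D0 z * (\<Sum>s\<in>I. c' z s * pmf (run null (D s) (k z)) v))"
      unfolding sum_distrib_left c'_def using ac by (intro sum.cong refl) auto
    also have "\<bar>\<dots>\<bar> \<le> (\<Sum>z\<in>{1..N}. pmf D0 z * \<bar>\<Sum>s\<in>I. c' z s * pmf (run null (D s) (k z)) v\<bar>)"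
      by (rule order_trans[OF sum_abs]) (simp add: abs_mult)
    also have "\<dots> \<le> (\<Sum>z\<in>{1..N}. pmf D0 z * ?B (c' z) q)"
      by (intro sum_mono mult_left_mono IH) auto
    also have "\<dots> = (\<Sum>z\<in>{1..N}. pmf D0 z * sqrt (gram I ?M (c' z) q))
        + real q * e * (\<Sum>z\<in>{1..N}. \<Sum>s\<in>I. pmf D0 z * \<bar>c' z s\<bar>)"
      by (simp add: algebra_simps sum.distrib sum_distrib_left)
    \<comment> \<open>The L1 norm is preserved because each likelihood ratio has mean 1 under
      \<open>D0\<close>.\<close>
    also have "(\<Sum>z\<in>{1..N}. \<Sum>s\<in>I. pmf D0 z * \<bar>c' z s\<bar>) = (\<Sum>z\<in>{1..N}. \<Sum>s\<in>I. \<bar>c s\<bar> * pmf (D s) z)"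
      using ac by (intro sum.cong refl) (auto simp: c'_def abs_mult)
    also have "\<dots> = (\<Sum>s\<in>I. \<Sum>z\<in>{1..N}. \<bar>c s\<bar> * pmf (D s) z)"
      by (rule sum.swap)
    also have "\<dots> = (\<Sum>s\<in>I. \<bar>c s\<bar>)"
      using sum_pmf_distribution_on[OF D] by (intro sum.cong refl) (simp flip: sum_distrib_left)
    also have "(\<Sum>z\<in>{1..N}. pmf D0 z * sqrt (gram I ?M (c' z) q)) \<le> sqrt (gram I ?M c (Suc q))"
    proof (rule real_le_rsqrt)
      have "(\<Sum>z\<in>{1..N}. pmf D0 z * sqrt (gram I ?M (c' z) q))\<^sup>2
          \<le> (\<Sum>z\<in>{1..N}. pmf D0 z * (sqrt (gram I ?M (c' z) q))\<^sup>2)"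
        by (rule sum_weighted_square_le) (use sum_pmf_distribution_on[OF D0] in auto)
      also have "\<dots> = (\<Sum>z\<in>{1..N}. pmf D0 z * gram I ?M (c' z) q)"
        using gram_bounds(2)[where D = D, OF D0 D ac, of I] by simp
      also have "\<dots> = gram I ?M c (Suc q)"
        unfolding c'_def by (rule gram_Suc[symmetric]) (rule ac)
      finally show "(\<Sum>z\<in>{1..N}. pmf D0 z * sqrt (gram I ?M (c' z) q))\<^sup>2 \<le> gram I ?M c (Suc q)" .
    qed
    finally have "\<bar>\<Sum>s\<in>I. c s * pmf (bind_pmf (D s) (\<lambda>z. run null (D s) (k z))) v\<bar>
       \<le> sqrt (gram I ?M c (Suc q)) + real q * e * (\<Sum>s\<in>I. \<bar>c s\<bar>)" by simp
    also have "\<dots> \<le> ?B c (Suc q)"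
      using e by (intro add_left_mono mult_right_mono) (auto intro!: sum_nonneg)
    finally show ?thesis .
  qed
  {
    case (Output q v')
    have "\<bar>\<Sum>s\<in>I. c s * pmf (return_pmf v') v\<bar> \<le> \<bar>\<Sum>s\<in>I. c s\<bar>"
      by (cases "v = v'") auto
    also have "\<dots> \<le> sqrt (gram I ?M c q)"
      using gram_bounds(1)[where D = D, OF D0 D ac, of I c q] real_le_rsqrt by fastforce
    also have "\<dots> \<le> ?B c q"
      using e by (auto intro!: sum_nonneg)
    finally show ?case by simp
  next
    case (Coin p q k)
    show ?case
      unfolding run.simps pmf_bind
      by (rule common) (use Coin.IH in \<open>auto simp: pmf_le_1\<close>)
  next
    case (Samp q k)
    show ?case
      unfolding run.simps by (rule samp) (rule Samp.IH)
  next
    case (Pcond x y q k)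
    from pc[OF Pcond.hyps(1-3)] show ?case
    proof
      assume "\<forall>E\<in>D ` I. pcond_oracle null E x y = E"
      then have "(\<Sum>s\<in>I. c s * pmf (run null (D s) (Pcond x y k)) v)
          = (\<Sum>s\<in>I. c s * pmf (bind_pmf (D s) (\<lambda>z. run null (D s) (k z))) v)"
        by (intro sum.cong refl) simp
      with samp[where k = k and q = q and c = c] Pcond.IH show ?thesis by simp
    next
      assume "uninformative null (D ` I) e x y"
      then obtain O' where O': "\<And>s f. s \<in> I \<Longrightarrow> (\<And>z. 0 \<le> f z \<and> f z \<le> (1::real)) \<Longrightarrow>
         \<bar>measure_pmf.expectation (pcond_oracle null (D s) x y) f - measure_pmf.expectation O' f\<bar> \<le> e"
        unfolding uninformative_def by blast
      \<comment> \<open>The continuation still depends on \<open>s\<close>; only the answer is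
        replaced, so the main term below is again a signed combination covered by the induction
        hypothesis.\<close>
      define P where "P s z = pmf (run null (D s) (k z)) v" for s z
      have P: "0 \<le> P s z \<and> P s z \<le> 1" for s z
        by (simp add: P_def pmf_le_1)
      have "(\<Sum>s\<in>I. c s * pmf (run null (D s) (Pcond x y k)) v)
        = (\<Sum>s\<in>I. c s * measure_pmf.expectation O' (P s)) +
          (\<Sum>s\<in>I. c s * (measure_pmf.expectation (pcond_oracle null (D s) x y) (P s) - measure_pmf.expectation O' (P s)))"
        unfolding run.simps pmf_bind P_def
        by (subst sum.distrib[symmetric], intro sum.cong refl) (simp add: algebra_simps)
      also have "\<bar>\<dots>\<bar> \<le> ?B c q + (\<Sum>s\<in>I. \<bar>c s\<bar> * e)"
      proof (rule order_trans[OF abs_triangle_ineq], rule add_mono)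
        show "\<bar>\<Sum>s\<in>I. c s * measure_pmf.expectation O' (P s)\<bar> \<le> ?B c q"
          by (rule common[OF P]) (use Pcond.IH in \<open>auto simp: P_def\<close>)
        show "\<bar>\<Sum>s\<in>I. c s * (measure_pmf.expectation (pcond_oracle null (D s) x y) (P s) - measure_pmf.expectation O' (P s))\<bar> \<le> (\<Sum>s\<in>I. \<bar>c s\<bar> * e)"
          by (rule order_trans[OF sum_abs])
             (auto simp: abs_mult intro!: sum_mono mult_left_mono O' P)
      qed
      also have "\<dots> = sqrt (gram I ?M c q) + real (Suc q) * e * (\<Sum>s\<in>I. \<bar>c s\<bar>)"
        by (simp add: algebra_simps sum_distrib_left sum.distrib)
      also have "\<dots> \<le> ?B c (Suc q)"
        using gram_mono_Suc[where D = D, OF D0 D ac, of I c q] by simp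
      finally show ?thesis .
    qed
  }
qed

text \<open>Coefficient 1 on the reference and \<open>- 1 / card S\<close> on each alternative.
  Overlaps with the reference are 1, so \<open>gram\<close> collapses to the chi-square divergence
  of the mixture of q-sample distributions; the absolute coefficients sum to 2, whence the factor 2
  before the oracle errors.\<close>

lemma mixture_distinguishing_bound:
  fixes D :: "'s \<Rightarrow> nat pmf"
  assumes fin: "finite S" and ne: "S \<noteq> {}"
    and D0: "distribution_on N D0"
    and D: "\<And>s. s \<in> S \<Longrightarrow> distribution_on N (D s)"
    and ac: "\<And>s z. s \<in> S \<Longrightarrow> pmf D0 z = 0 \<Longrightarrow> pmf (D s) z = 0"
    and e: "0 \<le> e"
    and pc: "\<And>x y. x \<in> {1..N} \<Longrightarrow> y \<in> {1..N} \<Longrightarrow> x \<noteq> y \<Longrightarrow>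
      uninformative null (insert D0 (D ` S)) e x y
      \<or> (\<forall>E\<in>insert D0 (D ` S). pcond_oracle null E x y = E)"
    and A: "query_bounded N q A"
  shows "pmf (run null D0 A) v - (\<Sum>s\<in>S. pmf (run null (D s) A) v) / card S
    \<le> sqrt ((\<Sum>s\<in>S. \<Sum>t\<in>S. overlap N D0 (D s) (D t) ^ q) / (card S)\<^sup>2 - 1) + 2 * real q * e"
proof -
  define I where "I = insert None (Some ` S)"
  define D' where "D' = case_option D0 D"
  define c where "c = case_option (1::real) (\<lambda>_::'s. - 1 / card S)"
  let ?M = "\<lambda>s t. overlap N D0 (D' s) (D' t)"
  have S0: "real (card S) \<noteq> 0" using fin ne by simp
  have sumI: "sum f I = f None + (\<Sum>s\<in>S. f (Some s))" for f :: "'s option \<Rightarrow> real"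
    unfolding I_def using fin by (subst sum.insert) (auto simp: sum.reindex)
  have rng: "D' ` I = insert D0 (D ` S)"
    by (auto simp: I_def D'_def image_iff)
  have dI: "distribution_on N (D' s)" if "s \<in> I" for s
    using that D0 D by (auto simp: I_def D'_def)
  have acI: "pmf (D' s) z = 0" if "s \<in> I" "pmf D0 z = 0" for s z
    using that ac by (auto simp: I_def D'_def)
  have pcI: "uninformative null (D' ` I) e x y \<or> (\<forall>E\<in>D' ` I. pcond_oracle null E x y = E)"
    if "x \<in> {1..N}" "y \<in> {1..N}" "x \<noteq> y" for x y
    using pc[OF that] by (simp only: rng)
  have M0: "?M None t = 1" "?M t None = 1" if "t \<in> I" for t
  proof -
    have "?M None t = (\<Sum>z\<in>{1..N}. pmf (D' t) z)"
      unfolding overlap_def using acI[OF that] by (intro sum.cong refl) (auto simp: D'_def)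
    then show "?M None t = 1" using sum_pmf_distribution_on[OF dI[OF that]] by simp
    then show "?M t None = 1" by (simp add: overlap_def mult.commute)
  qed
  have inI: "None \<in> I" "\<And>s. s \<in> S \<Longrightarrow> Some s \<in> I" by (auto simp: I_def)
  have "gram I ?M c q = (1 + (\<Sum>t\<in>S. - 1 / card S)) +
      (\<Sum>s\<in>S. - 1 / card S + (\<Sum>t\<in>S. overlap N D0 (D s) (D t) ^ q / (card S)\<^sup>2))"
    unfolding gram_def sumI
    by (intro arg_cong2[of _ _ _ _ "(+)"] sum.cong refl)
       (auto simp: M0 inI c_def power2_eq_square, auto simp: D'_def)
  also have "\<dots> = (\<Sum>s\<in>S. \<Sum>t\<in>S. overlap N D0 (D s) (D t) ^ q) / (card S)\<^sup>2 - 1"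
    using S0 by (simp add: sum.distrib sum_subtractf sum_divide_distrib sum_negf)
  finally have g: "gram I ?M c q = \<dots>" .
  have "(\<Sum>s\<in>I. \<bar>c s\<bar>) = 2"
    using S0 by (simp add: sumI c_def)
  moreover have "(\<Sum>s\<in>I. c s * pmf (run null (D' s) A) v) =
      pmf (run null D0 A) v - (\<Sum>s\<in>S. pmf (run null (D s) A) v) / card S"
    by (simp add: sumI c_def D'_def sum_divide_distrib sum_negf)
  ultimately show ?thesis
    using distinguishing_bound[where D = D' and I = I and c = c and v = v, OF D0 dI acI e pcI A]
    unfolding g by simp
qed

section \<open>Bucketed distributions\<close>

definition bucket_size :: "nat set \<Rightarrow> (nat \<Rightarrow> nat) \<Rightarrow> nat \<Rightarrow> real" where
  "bucket_size X \<beta> i = real (card {y \<in> X. \<beta> y = i})"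

definition bucket_pmf :: "nat set \<Rightarrow> (nat \<Rightarrow> nat) \<Rightarrow> (nat \<Rightarrow> real) \<Rightarrow> nat pmf" where
  "bucket_pmf X \<beta> w = embed_pmf (\<lambda>x. if x \<in> X then w (\<beta> x) / bucket_size X \<beta> (\<beta> x) else 0)"

text \<open>Strict positivity gives all members of a family the same support, hence absolute
  continuity and identical answers to \<open>Pcond\<close> queries that leave it.\<close>

definition weights :: "nat \<Rightarrow> (nat \<Rightarrow> real) \<Rightarrow> bool" where
  "weights n w \<longleftrightarrow> (\<forall>i<n. 0 < w i) \<and> (\<Sum>i<n. w i) = 1"

text \<open>\<open>X\<close> may be a proper part of \<open>{1..N}\<close>, as \<open>N\<close>
  rarely has the size that the buckets fill exactly; the rest carries no mass. Equality in the
  second assumption makes every bucket nonempty.\<close>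

locale buckets =
  fixes N :: nat and X :: "nat set" and \<beta> :: "nat \<Rightarrow> nat" and n :: nat
  assumes X: "X \<subseteq> {1..N}" and \<beta>: "\<beta> ` X = {..<n}"
begin

lemma finite_X: "finite X"
  using X finite_subset by blast

lemma \<beta>_less: "x \<in> X \<Longrightarrow> \<beta> x < n"
  using \<beta> by blast

lemma bucket_size_pos: "i < n \<Longrightarrow> 0 < bucket_size X \<beta> i"
  using \<beta> finite_X by (auto simp: bucket_size_def card_gt_0_iff) (metis imageE lessThan_iff)

text \<open>The summand is constant on a bucket and the size cancels. Through this identity,
  distances and overlaps depend on the weights alone.\<close>

lemma sum_over_buckets: "(\<Sum>x\<in>X. h (\<beta> x) / bucket_size X \<beta> (\<beta> x)) = (\<Sum>i<n. h i)"
proof -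
  have "(\<Sum>x\<in>X. h (\<beta> x) / bucket_size X \<beta> (\<beta> x)) =
      (\<Sum>i<n. \<Sum>x\<in>{x \<in> X. \<beta> x = i}. h (\<beta> x) / bucket_size X \<beta> (\<beta> x))"
    using \<beta> finite_X by (intro sum.group[symmetric]) auto
  also have "\<dots> = (\<Sum>i<n. h i)"
    using bucket_size_pos by (intro sum.cong refl) (auto simp: bucket_size_def)
  finally show ?thesis .
qed

lemma pmf_bucket_pmf:
  assumes w: "weights n w"
  shows "pmf (bucket_pmf X \<beta> w) x = (if x \<in> X then w (\<beta> x) / bucket_size X \<beta> (\<beta> x) else 0)"
proof -
  let ?f = "\<lambda>x. if x \<in> X then w (\<beta> x) / bucket_size X \<beta> (\<beta> x) else 0"
  have nn: "0 \<le> ?f x" for x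
    using w \<beta>_less by (auto simp: weights_def bucket_size_def less_imp_le)
  have "(\<integral>\<^sup>+x. ennreal (?f x) \<partial>count_space UNIV) = (\<Sum>x\<in>X. ennreal (?f x))"
    using finite_X by (subst nn_integral_count_space'[of X]) auto
  also have "\<dots> = ennreal (\<Sum>x\<in>X. ?f x)"
    by (rule sum_ennreal) (rule nn)
  also have "(\<Sum>x\<in>X. ?f x) = 1"
    using sum_over_buckets[of w] w by (simp add: weights_def)
  finally have "(\<integral>\<^sup>+x. ennreal (?f x) \<partial>count_space UNIV) = 1" by simp
  from pmf_embed_pmf[of ?f, OF nn this] show ?thesis
    unfolding bucket_pmf_def .
qed

lemma pmf_bucket_pmf_pos: "weights n w \<Longrightarrow> 0 < pmf (bucket_pmf X \<beta> w) x \<longleftrightarrow> x \<in> X"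
  using \<beta>_less[of x] bucket_size_pos[of "\<beta> x"] by (auto simp: pmf_bucket_pmf weights_def)

lemma distribution_on_bucket_pmf:
  "weights n w \<Longrightarrow> distribution_on N (bucket_pmf X \<beta> w)"
  using X by (auto simp: distribution_on_def set_pmf_eq pmf_bucket_pmf split: if_splits)

lemma tv_dist_bucket_pmf:
  assumes "weights n w" "weights n w'"
  shows "tv_dist N (bucket_pmf X \<beta> w) (bucket_pmf X \<beta> w') = 1 / 2 * (\<Sum>i<n. \<bar>w i - w' i\<bar>)"
proof -
  have "(\<Sum>x\<in>{1..N}. \<bar>pmf (bucket_pmf X \<beta> w) x - pmf (bucket_pmf X \<beta> w') x\<bar>)
    = (\<Sum>x\<in>X. \<bar>pmf (bucket_pmf X \<beta> w) x - pmf (bucket_pmf X \<beta> w') x\<bar>)"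
    using X by (intro sum.mono_neutral_right) (auto simp: pmf_bucket_pmf assms)
  also have "\<dots> = (\<Sum>x\<in>X. \<bar>w (\<beta> x) - w' (\<beta> x)\<bar> / bucket_size X \<beta> (\<beta> x))"
    by (intro sum.cong refl)
       (auto simp: pmf_bucket_pmf assms bucket_size_def simp flip: diff_divide_distrib)
  also have "\<dots> = (\<Sum>i<n. \<bar>w i - w' i\<bar>)"
    by (rule sum_over_buckets)
  finally show ?thesis
    by (simp add: tv_dist_def)
qed

lemma overlap_bucket_pmf:
  assumes "weights n w0" "weights n w" "weights n w'"
  shows "overlap N (bucket_pmf X \<beta> w0) (bucket_pmf X \<beta> w) (bucket_pmf X \<beta> w')
    = (\<Sum>i<n. w i * w' i / w0 i)"
proof -
  let ?p = "\<lambda>w. pmf (bucket_pmf X \<beta> w)"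
  have "(\<Sum>x\<in>{1..N}. ?p w x * ?p w' x / ?p w0 x) = (\<Sum>x\<in>X. ?p w x * ?p w' x / ?p w0 x)"
    using X by (intro sum.mono_neutral_right) (auto simp: pmf_bucket_pmf assms)
  also have "\<dots> = (\<Sum>x\<in>X. (w (\<beta> x) * w' (\<beta> x) / w0 (\<beta> x)) / bucket_size X \<beta> (\<beta> x))"
    using bucket_size_pos[OF \<beta>_less]
    by (intro sum.cong refl) (auto simp: pmf_bucket_pmf assms)
  also have "\<dots> = (\<Sum>i<n. w i * w' i / w0 i)"
    by (rule sum_over_buckets)
  finally show ?thesis
    by (simp add: overlap_def)
qed

end

section \<open>Answers of the pair oracle\<close>

lemma pmf_pcond_oracle:
  assumes "pmf E x + pmf E y \<noteq> 0"
  shows "pmf (pcond_oracle null E x y) z =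
    pmf E x / (pmf E x + pmf E y) * of_bool (z = x) + pmf E y / (pmf E x + pmf E y) * of_bool (z = y)"
proof -
  have "0 < pmf E x + pmf E y"
    using assms pmf_nonneg[of E x] pmf_nonneg[of E y] by linarith
  then have "1 - pmf E x / (pmf E x + pmf E y) = pmf E y / (pmf E x + pmf E y)"
    and "pmf E x / (pmf E x + pmf E y) \<le> 1"
    by (auto simp: field_simps)
  then show ?thesis using assms
    by (simp add: pcond_oracle_def map_pmf_def pmf_bind integral_bernoulli_pmf indicator_def)
qed

lemma expectation_pcond_oracle:
  fixes f :: "nat \<Rightarrow> real"
  assumes "pmf E x + pmf E y \<noteq> 0"
  shows "measure_pmf.expectation (pcond_oracle null E x y) f =
    pmf E x / (pmf E x + pmf E y) * f x + pmf E y / (pmf E x + pmf E y) * f y"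
proof -
  have "0 < pmf E x + pmf E y"
    using assms pmf_nonneg[of E x] pmf_nonneg[of E y] by linarith
  then have "1 - pmf E x / (pmf E x + pmf E y) = pmf E y / (pmf E x + pmf E y)"
    and "pmf E x / (pmf E x + pmf E y) \<le> 1"
    by (auto simp: field_simps)
  then show ?thesis using assms
    by (simp add: pcond_oracle_def integral_bernoulli_pmf mult.commute)
qed

text \<open>The error is the probability of the other element times the difference of
  \<open>f\<close> at the two points, and that probability is at most the ratio of the
  masses.\<close>

lemma pcond_oracle_near_return:
  fixes f :: "nat \<Rightarrow> real"
  assumes f: "\<And>z. 0 \<le> f z \<and> f z \<le> 1"
  shows "0 < pmf E x \<Longrightarrow> pmf E y \<le> e * pmf E x \<Longrightarrow>
      \<bar>measure_pmf.expectation (pcond_oracle null E x y) f - f x\<bar> \<le> e"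
    and "0 < pmf E y \<Longrightarrow> pmf E x \<le> e * pmf E y \<Longrightarrow>
      \<bar>measure_pmf.expectation (pcond_oracle null E x y) f - f y\<bar> \<le> e"
proof -
  have *: "\<bar>a / (a + b) * u + b / (a + b) * v - u\<bar> \<le> e"
    if "0 < a" "0 \<le> b" "b \<le> e * a" "0 \<le> u" "u \<le> 1" "0 \<le> v" "v \<le> 1" for a b u v :: real
  proof -
    have "a / (a + b) = 1 - b / (a + b)"
      using that by (simp add: field_simps)
    then have "a / (a + b) * u + b / (a + b) * v - u = (1 - b / (a + b)) * u + b / (a + b) * v - u"
      by simp
    also have "\<dots> = b / (a + b) * (v - u)"
      by (simp only: algebra_simps)
    also have "\<bar>\<dots>\<bar> = b / (a + b) * \<bar>v - u\<bar>"
      using that by (simp add: abs_mult)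
    also have "\<dots> \<le> b / a * 1"
      using that by (intro mult_mono divide_left_mono) auto
    also have "\<dots> \<le> e"
      using that by (simp add: field_simps)
    finally show ?thesis .
  qed
  show "\<bar>measure_pmf.expectation (pcond_oracle null E x y) f - f x\<bar> \<le> e"
    if "0 < pmf E x" "pmf E y \<le> e * pmf E x"
  proof -
    have "pmf E x + pmf E y \<noteq> 0"
      using that pmf_nonneg[of E y] by linarith
    then show ?thesis
      using *[of "pmf E x" "pmf E y" "f x" "f y"] f that
      by (subst expectation_pcond_oracle) auto
  qed
  show "\<bar>measure_pmf.expectation (pcond_oracle null E x y) f - f y\<bar> \<le> e"
    if "0 < pmf E y" "pmf E x \<le> e * pmf E y"
  proof -
    have "pmf E x + pmf E y \<noteq> 0"
      using that pmf_nonneg[of E x] by linarith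
    then show ?thesis
      using *[of "pmf E y" "pmf E x" "f y" "f x"] f that
      by (subst expectation_pcond_oracle) (auto simp: add.commute)
  qed
qed

lemma uninformative_return:
  assumes "(\<forall>E\<in>\<E>. 0 < pmf E x \<and> pmf E y \<le> e * pmf E x) \<or>
      (\<forall>E\<in>\<E>. 0 < pmf E y \<and> pmf E x \<le> e * pmf E y)"
  shows "uninformative null \<E> e x y"
  using assms
proof
  assume *: "\<forall>E\<in>\<E>. 0 < pmf E x \<and> pmf E y \<le> e * pmf E x"
  show ?thesis
    unfolding uninformative_def
  proof (intro exI[of _ "return_pmf x"] ballI allI impI)
    fix E and f :: "nat \<Rightarrow> real"
    assume "E \<in> \<E>" "\<forall>z. 0 \<le> f z \<and> f z \<le> 1"
    with * pcond_oracle_near_return(1)[of f E x y e null]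
    show "\<bar>measure_pmf.expectation (pcond_oracle null E x y) f - measure_pmf.expectation (return_pmf x) f\<bar> \<le> e"
      by simp
  qed
next
  assume *: "\<forall>E\<in>\<E>. 0 < pmf E y \<and> pmf E x \<le> e * pmf E y"
  show ?thesis
    unfolding uninformative_def
  proof (intro exI[of _ "return_pmf y"] ballI allI impI)
    fix E and f :: "nat \<Rightarrow> real"
    assume "E \<in> \<E>" "\<forall>z. 0 \<le> f z \<and> f z \<le> 1"
    with * pcond_oracle_near_return(2)[of f E y x e null]
    show "\<bar>measure_pmf.expectation (pcond_oracle null E x y) f - measure_pmf.expectation (return_pmf y) f\<bar> \<le> e"
      by simp
  qed
qed

lemma uninformative_eq:
  assumes "\<And>E. E \<in> \<E> \<Longrightarrow> pcond_oracle null E x y = O'" "0 \<le> e"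
  shows "uninformative null \<E> e x y"
  unfolding uninformative_def using assms by (intro exI[of _ O'] ballI allI impI) simp

context buckets
begin

text \<open>If exactly one element lies in \<open>X\<close>, it is returned with certainty; if
  neither does, the answer is \<open>null x y\<close>, which is arbitrary but the same for the whole
  family.\<close>

lemma uninformative_outside:
  assumes \<E>: "\<E> \<subseteq> bucket_pmf X \<beta> ` Collect (weights n)" and e: "0 \<le> e"
    and xy: "\<not> (x \<in> X \<and> y \<in> X)"
  shows "uninformative null \<E> e x y"
proof -
  have zero: "pmf E z = 0" if "E \<in> \<E>" "z \<notin> X" for E z
    using that \<E> by (auto simp: pmf_bucket_pmf)
  have pos: "0 < pmf E z" if "E \<in> \<E>" "z \<in> X" for E z
    using that \<E> by (auto simp: pmf_bucket_pmf_pos)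
  show ?thesis
  proof (cases "x \<in> X \<or> y \<in> X")
    case True
    with xy e show ?thesis
      by (intro uninformative_return) (auto simp: zero pos less_imp_le)
  next
    case False
    with e show ?thesis
      by (intro uninformative_eq[where O' = "null x y"]) (auto simp: pcond_oracle_def zero)
  qed
qed

text \<open>A point in a bucket of size \<open>s\<close> has mass at least \<open>a / s\<close>, one
  in any later bucket mass at most \<open>b / (K * s)\<close>; the quotient of the two is the
  error.\<close>

lemma uninformative_geometric:
  assumes \<E>: "\<E> \<subseteq> bucket_pmf X \<beta> ` {w. weights n w \<and> (\<forall>i<n. a \<le> w i \<and> w i \<le> b)}"
    and a: "0 < a" and K: "0 < K"
    and geo: "\<And>i i'. i < i' \<Longrightarrow> i' < n \<Longrightarrow> K * bucket_size X \<beta> i \<le> bucket_size X \<beta> i'"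
    and b: "0 \<le> b"
  shows "uninformative null \<E> (b / (a * K)) x y"
proof (cases "x \<in> X \<and> y \<in> X")
  case False
  have "\<E> \<subseteq> bucket_pmf X \<beta> ` Collect (weights n)" using \<E> by blast
  then show ?thesis using False a b K by (intro uninformative_outside) auto
next
  case True
  let ?e = "b / (a * K)"
  have le: "pmf E y \<le> ?e * pmf E x \<and> 0 < pmf E x"
    if "E \<in> \<E>" "x \<in> X" "y \<in> X" "\<beta> x < \<beta> y" for E x y
  proof -
    obtain w where w: "weights n w" "\<forall>i<n. a \<le> w i \<and> w i \<le> b" "E = bucket_pmf X \<beta> w"
      using subsetD[OF \<E> \<open>E \<in> \<E>\<close>] by auto
    define sx sy where "sx = bucket_size X \<beta> (\<beta> x)" "sy = bucket_size X \<beta> (\<beta> y)"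
    have s: "0 < sx" "0 < sy" "K * sx \<le> sy"
      using bucket_size_pos[OF \<beta>_less[OF \<open>x \<in> X\<close>]] bucket_size_pos[OF \<beta>_less[OF \<open>y \<in> X\<close>]]
        geo[OF \<open>\<beta> x < \<beta> y\<close> \<beta>_less[OF \<open>y \<in> X\<close>]] by (auto simp: sx_sy_def)
    have "pmf E y = w (\<beta> y) / sy"
      using that w by (simp add: pmf_bucket_pmf sx_sy_def)
    also have "\<dots> \<le> b / (K * sx)"
      using w(2) s K b \<beta>_less[OF \<open>y \<in> X\<close>] by (intro frac_le) auto
    also have "\<dots> = ?e * (a / sx)"
      using a by simp
    also have "\<dots> \<le> ?e * (w (\<beta> x) / sx)"
      using w(2) s a K b \<beta>_less[OF \<open>x \<in> X\<close>] by (intro mult_left_mono divide_right_mono) auto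
    also have "w (\<beta> x) / sx = pmf E x"
      using that w by (simp add: pmf_bucket_pmf sx_sy_def)
    finally have "pmf E y \<le> ?e * pmf E x" .
    moreover have "0 < pmf E x"
      using that w(1) by (simp add: w(3) pmf_bucket_pmf_pos)
    ultimately show ?thesis ..
  qed
  consider "\<beta> x < \<beta> y" | "\<beta> y < \<beta> x" | "\<beta> x = \<beta> y" by linarith
  then show ?thesis
  proof cases
    case 1
    then show ?thesis using le True by (intro uninformative_return disjI1 ballI) blast
  next
    case 2
    then show ?thesis using le True by (intro uninformative_return disjI2 ballI) blast
  next
    case 3
    let ?O = "map_pmf (\<lambda>b. if b then x else y) (bernoulli_pmf (1 / 2))"
    have "pcond_oracle null E x y = ?O" if "E \<in> \<E>" for E
    proof -
      obtain w where w: "weights n w" "E = bucket_pmf X \<beta> w"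
        using subsetD[OF \<E> \<open>E \<in> \<E>\<close>] by auto
      have "pmf E x = pmf E y"
        using w(1) True 3 by (simp add: w(2) pmf_bucket_pmf)
      moreover have "0 < pmf E x"
        using w(1) True by (simp add: w(2) pmf_bucket_pmf_pos)
      ultimately have "pmf E x = pmf E y" "0 < pmf E x" by auto
      then show ?thesis by (simp add: pcond_oracle_def)
    qed
    then show ?thesis using a b K by (intro uninformative_eq[where O' = ?O]) auto
  qed
qed

text \<open>The two masses already sum to 1, so conditioning on the pair changes nothing.\<close>

lemma pcond_oracle_two_points:
  assumes w: "weights n w" and X2: "X = {x, y}" "x \<noteq> y"
  shows "pcond_oracle null (bucket_pmf X \<beta> w) x y = bucket_pmf X \<beta> w"
proof (rule pmf_eqI)
  fix z
  define E where "E = bucket_pmf X \<beta> w"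
  have zero: "pmf E z = 0" if "z \<notin> X" for z
    using that by (simp add: E_def pmf_bucket_pmf w)
  have "(\<Sum>z\<in>X. pmf E z) = 1"
    by (rule sum_pmf_eq_1[OF finite_X]) (use zero in \<open>auto simp: set_pmf_eq\<close>)
  then have "pmf E x + pmf E y = 1"
    using X2 by simp
  moreover have "pmf E z = 0" if "z \<noteq> x" "z \<noteq> y"
    using that X2 zero by simp
  ultimately have "pmf (pcond_oracle null E x y) z = pmf E z"
    using X2(2) by (subst pmf_pcond_oracle) auto
  then show "pmf (pcond_oracle null (bucket_pmf X \<beta> w) x y) z = pmf (bucket_pmf X \<beta> w) z"
    by (simp only: E_def)
qed

end

section \<open>The second moment of the likelihood ratio\<close>

lemma sum_div_mod:
  fixes F :: "nat \<Rightarrow> nat \<Rightarrow> real"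
  shows "(\<Sum>i<r * m. F (i div m) (i mod m)) = (\<Sum>j<r. \<Sum>b<m. F j b)"
proof (induction r)
  case (Suc r)
  have "(\<Sum>i<Suc r * m. F (i div m) (i mod m)) =
      (\<Sum>i<r * m. F (i div m) (i mod m)) + (\<Sum>i\<in>{r * m..<r * m + m}. F (i div m) (i mod m))"
    by (subst sum.union_disjoint[symmetric]) (auto intro!: sum.cong)
  also have "(\<Sum>i\<in>{r * m..<r * m + m}. F (i div m) (i mod m)) =
      (\<Sum>b<m. F ((r * m + b) div m) ((r * m + b) mod m))"
    by (rule sum.reindex_bij_witness[of _ "\<lambda>b. r * m + b" "\<lambda>i. i - r * m"]) auto
  also have "\<dots> = (\<Sum>b<m. F r b)"
    by (intro sum.cong refl) simp
  finally show ?case using Suc.IH by simp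
qed simp

definition spike :: "nat \<Rightarrow> real \<Rightarrow> (nat \<Rightarrow> nat) \<Rightarrow> nat \<Rightarrow> real" where
  "spike m \<delta> s i = \<delta> * (real m * of_bool (i mod m = s (i div m)) - 1)"

definition spiked_weight :: "nat \<Rightarrow> nat \<Rightarrow> real \<Rightarrow> (nat \<Rightarrow> nat) \<Rightarrow> nat \<Rightarrow> real" where
  "spiked_weight r m \<delta> s i = (1 + spike m \<delta> s i) / real (r * m)"

lemma sum_spike:
  assumes "a < m"
  shows "(\<Sum>b<m. real m * of_bool (b = a) - 1) = 0"
  using assms by (simp add: sum_subtractf sum_distrib_left[symmetric] of_bool_def)

lemma sum_spike_mult:
  assumes "a < m" "a' < m"
  shows "(\<Sum>b<m. (real m * of_bool (b = a) - 1) * (real m * of_bool (b = a') - 1)) =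
     real m * (real m * of_bool (a = a') - 1)"
proof -
  have "(\<Sum>b<m. (real m * of_bool (b = a) - 1) * (real m * of_bool (b = a') - 1)) =
     (\<Sum>b<m. (real m)\<^sup>2 * of_bool (a = a') * of_bool (b = a) - (real m * of_bool (b = a) - 1) - real m * of_bool (b = a'))"
    by (intro sum.cong refl) (auto simp: power2_eq_square algebra_simps)
  also have "\<dots> = (real m)\<^sup>2 * of_bool (a = a') - real m"
    using assms by (simp add: sum_subtractf sum_distrib_left[symmetric] sum_spike of_bool_def)
  also have "\<dots> = real m * (real m * of_bool (a = a') - 1)"
    by (simp add: power2_eq_square algebra_simps)
  finally show ?thesis .
qed

text \<open>For negative x = - y, the bound follows from exp (- y) \<le> 1 / (1 + y) and (1 - y +
  y^2) (1 + y) = 1 + y^3.\<close>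

lemma exp_le_quadratic:
  fixes x :: real
  assumes "\<bar>x\<bar> \<le> 1"
  shows "exp x \<le> 1 + x + x\<^sup>2"
proof (cases "0 \<le> x")
  case True
  with assms show ?thesis by (intro exp_bound) auto
next
  case False
  define y where "y = - x"
  have y: "0 < y" "y \<le> 1" using assms False by (auto simp: y_def)
  have "exp x = 1 / exp y" by (simp add: y_def exp_minus field_simps)
  also have "\<dots> \<le> 1 / (1 + y)"
    using y exp_ge_add_one_self[of y] by (intro divide_left_mono) auto
  also have "\<dots> \<le> 1 - y + y\<^sup>2"
  proof -
    have "1 \<le> 1 + y ^ 3" using y by simp
    also have "\<dots> = (1 - y + y\<^sup>2) * (1 + y)"
      by (simp add: algebra_simps power2_eq_square power3_eq_cube)
    finally show ?thesis using y by (simp add: divide_le_eq)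
  qed
  finally show ?thesis by (simp add: y_def)
qed

text \<open>A moment generating function: the exponent has mean zero over \<open>b\<close>, so its
  linear term drops out. Replacing the variance by \<open>(\<tau> * real m)\<^sup>2\<close> loses
  only a factor depending on m.\<close>

lemma sum_exp_spike_le:
  assumes a: "a < m" and \<tau>: "0 \<le> \<tau>" "\<tau> * real m \<le> 1"
  shows "(\<Sum>b<m. exp (\<tau> * (real m * of_bool (b = a) - 1))) \<le> real m * exp ((\<tau> * real m)\<^sup>2)"
proof -
  let ?x = "\<lambda>b. \<tau> * (real m * of_bool (b = a) - 1)"
  have m: "1 \<le> real m" using a by simp
  have abs: "\<bar>?x b\<bar> \<le> \<tau> * real m" for b
    using m \<tau> mult_left_mono[OF m \<tau>(1)] by (auto simp: abs_mult intro!: mult_left_mono)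
  have "(\<Sum>b<m. exp (?x b)) \<le> (\<Sum>b<m. 1 + ?x b + (\<tau> * real m)\<^sup>2)"
  proof (rule sum_mono)
    fix b
    have "exp (?x b) \<le> 1 + ?x b + (?x b)\<^sup>2"
      using abs[of b] \<tau> by (intro exp_le_quadratic) linarith
    also have "(?x b)\<^sup>2 \<le> (\<tau> * real m)\<^sup>2"
      using power_mono[OF abs[of b], of 2] by (simp only: power2_abs abs_ge_zero)
    finally show "exp (?x b) \<le> 1 + ?x b + (\<tau> * real m)\<^sup>2" by simp
  qed
  also have "\<dots> = real m * (1 + (\<tau> * real m)\<^sup>2)"
    by (simp only: sum.distrib sum_distrib_left[symmetric] sum_spike[OF a]) (simp add: algebra_simps)
  also have "\<dots> \<le> real m * exp ((\<tau> * real m)\<^sup>2)"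
    by (intro mult_left_mono exp_ge_add_one_self) auto
  finally show ?thesis .
qed

abbreviation positions :: "nat \<Rightarrow> nat \<Rightarrow> (nat \<Rightarrow> nat) set" where
  "positions r m \<equiv> {..<r} \<rightarrow>\<^sub>E {..<m}"

text \<open>After \<open>1 + y \<le> exp y\<close> the groups decouple: for fixed \<open>s\<close>,
  the sum over \<open>t\<close> is a product of r moment generating functions at \<tau> = q
  \<delta>^2 / r. The bound on q says that \<tau> m \<le> 1, and nonnegativity permits taking q-th
  powers.\<close>

lemma average_power_le:
  assumes r: "0 < r" and \<delta>: "real q * \<delta>\<^sup>2 * real m \<le> real r"
    and nn: "\<And>s t. s \<in> positions r m \<Longrightarrow> t \<in> positions r m \<Longrightarrow>
      0 \<le> 1 + \<delta>\<^sup>2 / real r * (\<Sum>j<r. real m * of_bool (s j = t j) - 1)"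
  shows "(\<Sum>s\<in>positions r m. \<Sum>t\<in>positions r m.
      (1 + \<delta>\<^sup>2 / real r * (\<Sum>j<r. real m * of_bool (s j = t j) - 1)) ^ q)
    \<le> (real (card (positions r m)))\<^sup>2 * exp ((real q * \<delta>\<^sup>2 * real m)\<^sup>2 / real r)"
proof -
  define \<tau> where "\<tau> = real q * \<delta>\<^sup>2 / real r"
  have \<tau>: "0 \<le> \<tau>" "\<tau> * real m \<le> 1"
    using r \<delta> by (auto simp: \<tau>_def field_simps)
  have card: "real (card (positions r m)) = real m ^ r"
    by (simp add: card_PiE)
  have "(\<Sum>s\<in>positions r m. \<Sum>t\<in>positions r m.
      (1 + \<delta>\<^sup>2 / real r * (\<Sum>j<r. real m * of_bool (s j = t j) - 1)) ^ q) \<le>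
    (\<Sum>s\<in>positions r m. \<Sum>t\<in>positions r m. \<Prod>j<r. exp (\<tau> * (real m * of_bool (t j = s j) - 1)))"
  proof (intro sum_mono)
    fix s t assume st: "s \<in> positions r m" "t \<in> positions r m"
    let ?y = "\<delta>\<^sup>2 / real r * (\<Sum>j<r. real m * of_bool (s j = t j) - 1)"
    have "(1 + ?y) ^ q \<le> exp ?y ^ q"
      by (intro power_mono exp_ge_add_one_self nn st)
    also have "\<dots> = exp (real q * ?y)"
      by (rule exp_of_nat_mult[symmetric])
    also have "real q * ?y = \<tau> * (\<Sum>j<r. real m * of_bool (t j = s j) - 1)"
      unfolding eq_commute[of "t _"] by (simp add: \<tau>_def)
    also have "\<dots> = (\<Sum>j<r. \<tau> * (real m * of_bool (t j = s j) - 1))"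
      by (rule sum_distrib_left)
    also have "exp \<dots> = (\<Prod>j<r. exp (\<tau> * (real m * of_bool (t j = s j) - 1)))"
      by (rule exp_sum) simp
    finally show "(1 + ?y) ^ q \<le> \<dots>" .
  qed
  also have "\<dots> \<le> (\<Sum>s\<in>positions r m. (real m * exp ((\<tau> * real m)\<^sup>2)) ^ r)"
  proof (rule sum_mono)
    fix s assume s: "s \<in> positions r m"
    have "(\<Sum>t\<in>positions r m. \<Prod>j<r. exp (\<tau> * (real m * of_bool (t j = s j) - 1))) =
        (\<Prod>j<r. \<Sum>b<m. exp (\<tau> * (real m * of_bool (b = s j) - 1)))"
      by (rule prod_sum_PiE[symmetric]) auto
    also have "\<dots> \<le> (\<Prod>j<r. real m * exp ((\<tau> * real m)\<^sup>2))"
      using s \<tau> by (intro prod_mono conjI sum_nonneg sum_exp_spike_le) auto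
    finally show "(\<Sum>t\<in>positions r m. \<Prod>j<r. exp (\<tau> * (real m * of_bool (t j = s j) - 1)))
       \<le> (real m * exp ((\<tau> * real m)\<^sup>2)) ^ r" by (simp only: prod_constant card_lessThan)
  qed
  also have "\<dots> = (real (card (positions r m)))\<^sup>2 * exp ((\<tau> * real m)\<^sup>2) ^ r"
    by (simp add: card power_mult_distrib power2_eq_square)
  also have "exp ((\<tau> * real m)\<^sup>2) ^ r = exp ((real q * \<delta>\<^sup>2 * real m)\<^sup>2 / real r)"
    using r by (simp add: \<tau>_def exp_of_nat_mult[symmetric] power2_eq_square field_simps)
  finally show ?thesis .
qed

section \<open>Spiked families\<close>

text \<open>Bucket \<open>i\<close> is member \<open>i mod m\<close> of group \<open>i div m\<close>; \<open>s\<close> selects one heavier member in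
  each of the \<open>r\<close> groups.\<close>

locale spiked_buckets = buckets N X \<beta> "r * m" for N X \<beta> r m +
  fixes \<delta> :: real
  assumes r: "0 < r" and m: "2 \<le> m" and \<delta>: "0 < \<delta>" "\<delta> < 1"
begin

abbreviation "level \<equiv> bucket_pmf X \<beta> (\<lambda>_. 1 / real (r * m))"
abbreviation "spiked s \<equiv> bucket_pmf X \<beta> (spiked_weight r m \<delta> s)"

section \<open>Weights, distances and overlaps in a spiked family\<close>

lemma rm_pos: "0 < real r * real m"
  using r m by simp

lemma weights_level: "weights (r * m) (\<lambda>_. 1 / real (r * m))"
  using r m by (simp add: weights_def)

lemma position_less: "s \<in> positions r m \<Longrightarrow> j < r \<Longrightarrow> s j < m"
  by (auto dest: PiE_mem)

text \<open>The two bounds differ by the factor m / (1 - \<delta>), so the error of a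
  \<open>Pcond\<close> answer will not depend on the number of groups.\<close>

lemma spiked_weight_bounds:
  "(1 - \<delta>) / real (r * m) \<le> spiked_weight r m \<delta> s i" "spiked_weight r m \<delta> s i \<le> real m / real (r * m)"
proof -
  define d where "d = \<delta> * (real m - 1)"
  have d: "d \<le> 1 * (real m - 1)"
    unfolding d_def using m \<delta> by (intro mult_right_mono) auto
  have "0 \<le> d" "2 \<le> real m"
    using m \<delta> by (simp_all add: d_def)
  have "spike m \<delta> s i = d \<or> spike m \<delta> s i = - \<delta>"
    by (simp add: spike_def d_def)
  then have "1 - \<delta> \<le> 1 + spike m \<delta> s i \<and> 1 + spike m \<delta> s i \<le> real m"
    using \<delta> d \<open>0 \<le> d\<close> \<open>2 \<le> real m\<close> by (auto simp: algebra_simps)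
  then show "(1 - \<delta>) / real (r * m) \<le> spiked_weight r m \<delta> s i" "spiked_weight r m \<delta> s i \<le> real m / real (r * m)"
    unfolding spiked_weight_def by (intro divide_right_mono; simp)+
qed

lemma sum_spike_all:
  assumes "s \<in> positions r m"
  shows "(\<Sum>i<r * m. spike m \<delta> s i) = 0"
proof -
  have "(\<Sum>i<r * m. spike m \<delta> s i) = (\<Sum>j<r. \<Sum>b<m. \<delta> * (real m * of_bool (b = s j) - 1))"
    unfolding spike_def by (rule sum_div_mod)
  also have "\<dots> = 0"
    by (rule sum.neutral, rule ballI)
       (simp only: sum_distrib_left[symmetric] sum_spike[OF position_less[OF assms]] lessThan_iff mult_zero_right)
  finally show ?thesis .
qed

lemma weights_spiked:
  assumes "s \<in> positions r m"
  shows "weights (r * m) (spiked_weight r m \<delta> s)"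
  unfolding weights_def
proof (intro conjI allI impI)
  fix i
  have "0 < (1 - \<delta>) / real (r * m)" using \<delta> rm_pos by simp
  also have "\<dots> \<le> spiked_weight r m \<delta> s i" by (rule spiked_weight_bounds)
  finally show "0 < spiked_weight r m \<delta> s i" .
next
  show "(\<Sum>i<r * m. spiked_weight r m \<delta> s i) = 1"
    using sum_spike_all[OF assms] r m
    by (simp add: spiked_weight_def sum_divide_distrib[symmetric] sum.distrib)
qed

lemma tv_dist_spiked:
  assumes s: "s \<in> positions r m"
  shows "tv_dist N (spiked s) level = \<delta> * (real m - 1) / real m"
proof -
  have "(\<Sum>i<r * m. \<bar>spiked_weight r m \<delta> s i - 1 / real (r * m)\<bar>) =
      (\<Sum>i<r * m. \<delta> / real (r * m) * \<bar>real m * of_bool (i mod m = s (i div m)) - 1\<bar>)"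
    using \<delta> by (intro sum.cong refl)
       (simp add: spiked_weight_def spike_def abs_mult flip: diff_divide_distrib)
  also have "\<dots> = (\<Sum>j<r. \<Sum>b<m. \<delta> / real (r * m) * \<bar>real m * of_bool (b = s j) - 1\<bar>)"
    by (rule sum_div_mod)
  also have "\<dots> = (\<Sum>j<r. \<delta> / real (r * m) * (2 * (real m - 1)))"
  proof (intro sum.cong refl)
    fix j assume j: "j \<in> {..<r}"
    \<comment> \<open>The selected member contributes m - 1, each of the m - 1 others contributes
      1.\<close>
    have "(\<Sum>b<m. \<bar>real m * of_bool (b = s j) - 1\<bar>) = (\<Sum>b<m. 1 + (real m - 2) * of_bool (b = s j))"
      using m by (intro sum.cong refl) auto
    also have "\<dots> = 2 * (real m - 1)"
      using position_less[OF s, of j] j by (simp add: sum.distrib of_bool_def flip: sum_distrib_left)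
    finally show "(\<Sum>b<m. \<delta> / real (r * m) * \<bar>real m * of_bool (b = s j) - 1\<bar>) =
        \<delta> / real (r * m) * (2 * (real m - 1))"
      by (simp only: sum_distrib_left[symmetric])
  qed
  also have "\<dots> = 2 * (\<delta> * (real m - 1) / real m)"
    using r m by (simp add: field_simps)
  finally show ?thesis
    using tv_dist_bucket_pmf[OF weights_spiked[OF s] weights_level] by simp
qed

text \<open>Linear terms cancel since spikes sum to zero. The bilinear term splits by groups, where
  two centred indicators have inner product m^2 - m if they agree and - m otherwise.\<close>

lemma overlap_spiked:
  assumes s: "s \<in> positions r m" and t: "t \<in> positions r m"
  shows "overlap N level (spiked s) (spiked t) =
    1 + \<delta>\<^sup>2 / real r * (\<Sum>j<r. real m * of_bool (s j = t j) - 1)"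
proof -
  have "overlap N level (spiked s) (spiked t) =
      (\<Sum>i<r * m. spiked_weight r m \<delta> s i * spiked_weight r m \<delta> t i / (1 / real (r * m)))"
    by (rule overlap_bucket_pmf[OF weights_level weights_spiked[OF s] weights_spiked[OF t]])
  also have "\<dots> = (\<Sum>i<r * m. (1 + spike m \<delta> s i + spike m \<delta> t i + spike m \<delta> s i * spike m \<delta> t i) / real (r * m))"
    using r m by (intro sum.cong refl) (simp add: spiked_weight_def field_simps)
  also have "\<dots> = 1 + (\<Sum>i<r * m. spike m \<delta> s i * spike m \<delta> t i) / real (r * m)"
    using r m sum_spike_all[OF s] sum_spike_all[OF t]
    by (simp add: sum_divide_distrib[symmetric] sum.distrib add_divide_distrib)
  also have "(\<Sum>i<r * m. spike m \<delta> s i * spike m \<delta> t i) =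
     (\<Sum>i<r * m. \<delta>\<^sup>2 * ((real m * of_bool (i mod m = s (i div m)) - 1) * (real m * of_bool (i mod m = t (i div m)) - 1)))"
    by (intro sum.cong refl) (simp add: spike_def power2_eq_square)
  also have "\<dots> = (\<Sum>j<r. \<Sum>b<m. \<delta>\<^sup>2 * ((real m * of_bool (b = s j) - 1) * (real m * of_bool (b = t j) - 1)))"
    by (rule sum_div_mod)
  also have "\<dots> = (\<Sum>j<r. \<delta>\<^sup>2 * (real m * (real m * of_bool (s j = t j) - 1)))"
    using position_less[OF s] position_less[OF t]
    by (intro sum.cong refl) (simp add: sum_distrib_left[symmetric] sum_spike_mult)
  also have "\<dots> / real (r * m) = \<delta>\<^sup>2 / real r * (\<Sum>j<r. real m * of_bool (s j = t j) - 1)"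
    using r m by (simp only: sum_distrib_left[symmetric]) simp
  finally show ?thesis .
qed

lemma family_subset:
  "insert level (spiked ` positions r m) \<subseteq> bucket_pmf X \<beta> `
    {w. weights (r * m) w \<and> (\<forall>i<r * m. (1 - \<delta>) / real (r * m) \<le> w i \<and> w i \<le> real m / real (r * m))}"
proof -
  have "(1 - \<delta>) / real (r * m) \<le> 1 / real (r * m)" "1 / real (r * m) \<le> real m / real (r * m)"
    using \<delta> m by (intro divide_right_mono; simp)+
  then show ?thesis
    using weights_level weights_spiked spiked_weight_bounds by (auto simp del: of_nat_mult)
qed

text \<open>A tester accepts the reference with probability at least 2/3 and the uniform mixture of
  the alternatives with probability at most 1/3; the gap has to be covered by the distinguishing
  bound.\<close>

lemma tester_lower_bound:
  assumes e: "0 \<le> e"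
    and pc: "\<And>x y. x \<in> {1..N} \<Longrightarrow> y \<in> {1..N} \<Longrightarrow> x \<noteq> y \<Longrightarrow>
      uninformative null (insert level (spiked ` positions r m)) e x y
      \<or> (\<forall>E\<in>insert level (spiked ` positions r m). pcond_oracle null E x y = E)"
    and A: "query_bounded N q A"
    and tester: "identity_tester null N level (\<delta> * (real m - 1) / real m) A"
    and q: "real q * \<delta>\<^sup>2 * real m \<le> real r"
  shows "1 / 3 \<le> sqrt (exp ((real q * \<delta>\<^sup>2 * real m)\<^sup>2 / real r) - 1) + 2 * real q * e"
proof -
  let ?S = "positions r m"
  have S: "finite ?S" "?S \<noteq> {}"
    using m by (auto simp: finite_PiE PiE_eq_empty_iff lessThan_empty_iff)
  then have card: "0 < real (card ?S)" by (simp add: card_gt_0_iff)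
  have dist: "distribution_on N (spiked s)" if "s \<in> ?S" for s
    using that by (intro distribution_on_bucket_pmf weights_spiked)
  have "1 / 3 \<le> pmf (run null level A) ACCEPT - (\<Sum>s\<in>?S. pmf (run null (spiked s) A) ACCEPT) / card ?S"
  proof -
    have "(\<Sum>s\<in>?S. pmf (run null (spiked s) A) ACCEPT) \<le> (\<Sum>s\<in>?S. 1 / 3)"
    proof (rule sum_mono)
      fix s assume s: "s \<in> ?S"
      have "2 / 3 \<le> pmf (run null (spiked s) A) REJECT"
        using tester dist[OF s] tv_dist_spiked[OF s] by (simp add: identity_tester_def)
      moreover have "(\<Sum>v\<in>{ACCEPT, REJECT}. pmf (run null (spiked s) A) v) \<le> 1"
        by (subst sum_pmf_eq_1) (auto intro: verdict.exhaust)
      ultimately show "pmf (run null (spiked s) A) ACCEPT \<le> 1 / 3" by simp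
    qed
    then have "(\<Sum>s\<in>?S. pmf (run null (spiked s) A) ACCEPT) / card ?S \<le> 1 / 3"
      using card by (simp add: divide_le_eq)
    moreover have "2 / 3 \<le> pmf (run null level A) ACCEPT"
      using tester by (simp add: identity_tester_def)
    ultimately show ?thesis by linarith
  qed
  also have "\<dots> \<le> sqrt ((\<Sum>s\<in>?S. \<Sum>t\<in>?S. overlap N level (spiked s) (spiked t) ^ q) / (card ?S)\<^sup>2 - 1) + 2 * real q * e"
  proof (rule mixture_distinguishing_bound[OF S _ dist _ e _ A])
    show "distribution_on N level"
      by (intro distribution_on_bucket_pmf weights_level)
    show "pmf (spiked s) z = 0" if "s \<in> ?S" "pmf level z = 0" for s z
    proof -
      have "z \<notin> X"
        using pmf_bucket_pmf_pos[OF weights_level, of z] that(2) by linarith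
      then show ?thesis
        by (simp only: pmf_bucket_pmf[OF weights_spiked[OF that(1)]] if_False)
    qed
  qed (use pc in auto)
  also have "(\<Sum>s\<in>?S. \<Sum>t\<in>?S. overlap N level (spiked s) (spiked t) ^ q) / (card ?S)\<^sup>2
      \<le> exp ((real q * \<delta>\<^sup>2 * real m)\<^sup>2 / real r)"
  proof -
    have "(\<Sum>s\<in>?S. \<Sum>t\<in>?S. overlap N level (spiked s) (spiked t) ^ q) =
      (\<Sum>s\<in>?S. \<Sum>t\<in>?S. (1 + \<delta>\<^sup>2 / real r * (\<Sum>j<r. real m * of_bool (s j = t j) - 1)) ^ q)"
      by (intro sum.cong refl) (simp only: overlap_spiked)
    also have "\<dots> \<le> (real (card ?S))\<^sup>2 * exp ((real q * \<delta>\<^sup>2 * real m)\<^sup>2 / real r)"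
    proof (rule average_power_le[OF r q])
      fix s t assume "s \<in> ?S" "t \<in> ?S"
      then have "1 + \<delta>\<^sup>2 / real r * (\<Sum>j<r. real m * of_bool (s j = t j) - 1) = overlap N level (spiked s) (spiked t)"
        by (rule overlap_spiked[symmetric])
      also have "0 \<le> \<dots>" by (auto simp: overlap_def intro!: sum_nonneg)
      finally show "0 \<le> 1 + \<delta>\<^sup>2 / real r * (\<Sum>j<r. real m * of_bool (s j = t j) - 1)" .
    qed
    finally show ?thesis using card by (simp add: divide_le_eq mult.commute)
  qed
  finally show ?thesis by simp
qed

end

section \<open>Separated buckets and two points\<close>

text \<open>If both alternatives failed, the exponent would be at most 1/100, and the gap of 1/3
  would be at most 1/7 + 1/10.\<close>

lemma (in spiked_buckets) tester_query_bound:
  assumes "0 \<le> e"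
    and "\<And>x y. x \<in> {1..N} \<Longrightarrow> y \<in> {1..N} \<Longrightarrow> x \<noteq> y \<Longrightarrow>
      uninformative null (insert level (spiked ` positions r m)) e x y
      \<or> (\<forall>E\<in>insert level (spiked ` positions r m). pcond_oracle null E x y = E)"
    and "query_bounded N q A"
    and "identity_tester null N level (\<delta> * (real m - 1) / real m) A"
  shows "sqrt (real r) / 10 < real q * \<delta>\<^sup>2 * real m \<or> 1 / 20 < real q * e"
proof (rule ccontr)
  define T where "T = real q * \<delta>\<^sup>2 * real m"
  assume "\<not> ?thesis"
  then have T: "T \<le> sqrt (real r) / 10" and qe: "real q * e \<le> 1 / 20"
    by (auto simp: T_def)
  have T0: "0 \<le> T" by (simp add: T_def)
  have "1 \<le> real r" using r by simp
  then have "1 * sqrt (real r) \<le> sqrt (real r) * sqrt (real r)"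
    by (intro mult_right_mono) auto
  then have "sqrt (real r) \<le> real r" by simp
  with T have "T \<le> real r" by linarith
  have "T\<^sup>2 \<le> (sqrt (real r) / 10)\<^sup>2"
    using T T0 by (rule power_mono)
  then have "T\<^sup>2 / real r \<le> 1 / 100"
    using r by (simp add: power_divide field_simps)
  then have "exp (T\<^sup>2 / real r) \<le> exp (1 / 100)" by simp
  also have "\<dots> \<le> 1 + 1 / 100 + (1 / 100)\<^sup>2"
    by (rule exp_le_quadratic) simp
  also have "\<dots> \<le> 1 + (1 / 7)\<^sup>2"
    by (simp add: power2_eq_square)
  finally have "sqrt (exp (T\<^sup>2 / real r) - 1) \<le> 1 / 7"
    by (intro real_le_lsqrt) auto
  moreover have "1 / 3 \<le> sqrt (exp (T\<^sup>2 / real r) - 1) + 2 * real q * e"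
    using tester_lower_bound[OF assms] \<open>T \<le> real r\<close> by (simp add: T_def)
  ultimately show False using qe by linarith
qed

text \<open>\<open>\<beta>\<close> is the position of the leading digit in base \<open>K\<close>, so
  bucket \<open>i\<close> runs from \<open>K ^ i\<close> to \<open>K ^ (i + 1) - 1\<close> and
  consecutive sizes have ratio exactly \<open>K\<close>.\<close>

lemma geometric_buckets:
  assumes K: "2 \<le> K" and N: "K ^ n \<le> N"
  defines "\<beta> \<equiv> \<lambda>x. nat \<lfloor>log (real K) (real x)\<rfloor>"
  shows "buckets N {1..<K ^ n} \<beta> n"
    and "i < n \<Longrightarrow> bucket_size {1..<K ^ n} \<beta> i = real K ^ i * (real K - 1)"
proof -
  have \<beta>: "\<beta> x = i \<longleftrightarrow> K ^ i \<le> x \<and> x < K ^ (i + 1)" if "0 < x" for x i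
  proof -
    have "0 \<le> \<lfloor>log (real K) (real x)\<rfloor>" using K that by simp
    then have "\<beta> x = i \<longleftrightarrow> \<lfloor>log (real K) (real x)\<rfloor> = int i"
      unfolding \<beta>_def by linarith
    also have "\<dots> \<longleftrightarrow> K ^ i \<le> x \<and> x < K ^ (i + 1)"
      by (rule floor_log_nat_eq_powr_iff[OF K that])
    finally show ?thesis .
  qed
  have le: "K ^ (i + 1) \<le> K ^ n" if "i < n" for i
    using K that by (intro power_increasing) auto
  have pos: "0 < K ^ i" for i using K by simp
  have bucket: "{x \<in> {1..<K ^ n}. \<beta> x = i} = {K ^ i..<K ^ (i + 1)}" if "i < n" for i
  proof (intro set_eqI iffI)
    fix x assume "x \<in> {x \<in> {1..<K ^ n}. \<beta> x = i}"
    then show "x \<in> {K ^ i..<K ^ (i + 1)}" using \<beta>[of x i] by auto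
  next
    fix x assume x: "x \<in> {K ^ i..<K ^ (i + 1)}"
    then have "0 < x" using pos[of i] by (simp only: atLeastLessThan_iff) linarith
    moreover have "x < K ^ n"
      using x le[OF that] by (auto intro: less_le_trans)
    ultimately show "x \<in> {x \<in> {1..<K ^ n}. \<beta> x = i}"
      using x \<beta>[of x i] by auto
  qed
  show "buckets N {1..<K ^ n} \<beta> n"
  proof
    show "{1..<K ^ n} \<subseteq> {1..N}" using N by auto
    show "\<beta> ` {1..<K ^ n} = {..<n}"
    proof (intro equalityI subsetI)
      fix i assume "i \<in> \<beta> ` {1..<K ^ n}"
      then obtain x where x: "x \<in> {1..<K ^ n}" "i = \<beta> x" by blast
      then have x: "0 < x" "x < K ^ n" "\<beta> x = i" by auto
      then have "K ^ i < K ^ n" using \<beta>[OF x(1), of i] by linarith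
      then show "i \<in> {..<n}" using K by simp
    next
      fix i assume "i \<in> {..<n}"
      then have "K ^ i \<in> {x \<in> {1..<K ^ n}. \<beta> x = i}"
        using K bucket[of i] by simp
      then show "i \<in> \<beta> ` {1..<K ^ n}"
        by (intro image_eqI[of _ _ "K ^ i"]) (simp_all only: mem_Collect_eq)
    qed
  qed
  show "bucket_size {1..<K ^ n} \<beta> i = real K ^ i * (real K - 1)" if "i < n"
    using K bucket[OF that] by (simp add: bucket_size_def of_nat_diff algebra_simps)
qed

lemma geometric_lower_bound:
  assumes K: "2 \<le> K" "K ^ (r * m) \<le> N" and r: "0 < r" and m: "2 \<le> m" and \<delta>: "0 < \<delta>" "\<delta> < 1"
  shows "\<exists>Dstar. distribution_on N Dstar \<and>
    (\<forall>null A q. query_bounded N q A \<longrightarrow> identity_tester null N Dstar (\<delta> * (real m - 1) / real m) A \<longrightarrow>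
      sqrt (real r) / 10 < real q * \<delta>\<^sup>2 * real m \<or> 1 / 20 < real q * (real m / ((1 - \<delta>) * real K)))"
proof -
  define X \<beta> where "X = {1..<K ^ (r * m)}" and "\<beta> = (\<lambda>x. nat \<lfloor>log (real K) (real x)\<rfloor>)"
  interpret buckets N X \<beta> "r * m"
    unfolding X_def \<beta>_def by (rule geometric_buckets[OF K])
  interpret spiked_buckets N X \<beta> r m \<delta>
    by unfold_locales (fact r m \<delta>)+
  have geo: "real K * bucket_size X \<beta> i \<le> bucket_size X \<beta> i'" if "i < i'" "i' < r * m" for i i'
  proof -
    have "real K * real K ^ i \<le> real K ^ i'"
      using that K power_increasing[of "Suc i" i' "real K"] by simp
    then have "real K * real K ^ i * (real K - 1) \<le> real K ^ i' * (real K - 1)"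
      using K by (intro mult_right_mono) auto
    moreover have "bucket_size X \<beta> i = real K ^ i * (real K - 1)"
      "bucket_size X \<beta> i' = real K ^ i' * (real K - 1)"
      unfolding X_def \<beta>_def using that by (intro geometric_buckets(2)[OF K]; simp)+
    ultimately show ?thesis by simp
  qed
  have unf: "uninformative null (insert level (spiked ` positions r m)) (real m / ((1 - \<delta>) * real K)) x y"
    for null x y
  proof -
    have "uninformative null (insert level (spiked ` positions r m))
       (real m / real (r * m) / ((1 - \<delta>) / real (r * m) * real K)) x y"
      using r m \<delta> K by (intro uninformative_geometric[OF family_subset] geo) auto
    then show ?thesis using r m by simp
  qed
  have "0 \<le> real m / ((1 - \<delta>) * real K)" using \<delta> by simp
  from tester_query_bound[OF this] show ?thesis
    using unf distribution_on_bucket_pmf[OF weights_level] by blast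
qed

text \<open>On two points \<open>Pcond\<close> is just \<open>Samp\<close>, so no separation of the buckets is needed.\<close>

lemma two_point_lower_bound:
  assumes N: "2 \<le> N" and \<delta>: "0 < \<delta>" "\<delta> < 1"
  shows "\<exists>Dstar. distribution_on N Dstar \<and>
    (\<forall>null A q. query_bounded N q A \<longrightarrow> identity_tester null N Dstar (\<delta> / 2) A \<longrightarrow>
      1 / 20 < real q * \<delta>\<^sup>2)"
proof -
  define X \<beta> where "X = {1, 2::nat}" and "\<beta> = (\<lambda>x. x - 1 :: nat)"
  \<comment> \<open>Written as a product to match the bucket count \<open>r * m\<close> of the
    spiked family.\<close>
  interpret buckets N X \<beta> "1 * 2"
    using N by unfold_locales (auto simp: X_def \<beta>_def)
  interpret spiked_buckets N X \<beta> 1 2 \<delta>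
    by unfold_locales (use \<delta> in auto)
  let ?F = "insert level (spiked ` positions 1 2)"
  have w: "?F \<subseteq> bucket_pmf X \<beta> ` Collect (weights (1 * 2))"
    using family_subset by blast
  have unf: "uninformative null ?F 0 x y \<or> (\<forall>E\<in>?F. pcond_oracle null E x y = E)" if "x \<noteq> y" for null x y
  proof (cases "x \<in> X \<and> y \<in> X")
    case True
    with that have xy: "X = {x, y}" by (auto simp: X_def)
    have "pcond_oracle null E x y = E" if "E \<in> ?F" for E
    proof -
      obtain v where "weights (1 * 2) v" and E: "E = bucket_pmf X \<beta> v"
        using subsetD[OF w \<open>E \<in> ?F\<close>] by (elim imageE CollectE)
      then show ?thesis
        unfolding E by (intro pcond_oracle_two_points xy \<open>x \<noteq> y\<close>)
    qed
    then show ?thesis by blast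
  next
    case False
    then show ?thesis by (intro disjI1 uninformative_outside[OF w] order_refl)
  qed
  \<comment> \<open>The oracle error is 0 here, so the second alternative is void.\<close>
  have bound: "sqrt (real 1) / 10 < real q * \<delta>\<^sup>2 * real 2 \<or> 1 / 20 < real q * 0"
    if "query_bounded N q A" "identity_tester null N level (\<delta> * (real 2 - 1) / real 2) A" for null A q
  proof (rule tester_query_bound)
    show "uninformative null ?F 0 x y \<or> (\<forall>E\<in>?F. pcond_oracle null E x y = E)" if "x \<noteq> y" for x y
      using that by (rule unf)
  qed (use that in auto)
  have "1 / 20 < real q * \<delta>\<^sup>2"
    if "query_bounded N q A" "identity_tester null N level (\<delta> / 2) A" for null A q
    using bound[OF that(1), of null] that(2) by (simp add: mult_ac)
  then show ?thesis
    using distribution_on_bucket_pmf[OF weights_level] by blast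
qed

section \<open>Choice of the parameters\<close>

text \<open>The last condition serves the case in which no group of buckets fits: it confines that
  case to \<epsilon> < 1/2.\<close>

lemma eventually_ln_ge:
  assumes "0 < M"
  shows "\<forall>\<^sub>F N :: nat in sequentially. 2 \<le> N \<and> 3 \<le> ln (real N) \<and> M * ln (2 * ln (real N)) \<le> ln (real N)"
proof (intro eventually_conj)
  show "\<forall>\<^sub>F N :: nat in sequentially. 2 \<le> N" by (rule eventually_ge_at_top)
  show "\<forall>\<^sub>F N :: nat in sequentially. 3 \<le> ln (real N)" by real_asymp
  show "\<forall>\<^sub>F N :: nat in sequentially. M * ln (2 * ln (real N)) \<le> ln (real N)"
    using assms by real_asymp
qed

text \<open>From K \<le> (L / \<epsilon>)^2 it follows that ln K \<le> 2 ln (L / \<epsilon>), and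
  \<open>R\<close> is the value of r for which r m times this bound equals ln N. Rounding down loses
  at most a factor 2 because \<open>R \<ge> 1\<close>. The last claim makes the limit from
  \<open>Pcond\<close> errors, of order \<open>K\<close>, no weaker than the target.\<close>

lemma bucket_parameters:
  fixes L \<epsilon> :: real and m N :: nat
  defines "R \<equiv> L / (2 * real m * ln (L / \<epsilon>))"
  defines "r \<equiv> nat \<lfloor>R\<rfloor>" and "K \<equiv> nat \<lceil>L / \<epsilon>\<^sup>2\<rceil>"
  assumes L: "3 \<le> L" "L = ln (real N)" and \<epsilon>: "0 < \<epsilon>" "\<epsilon> < 1" and m: "2 \<le> m" and R: "1 \<le> R"
    and N: "2 \<le> N"
  shows "0 < r" and "2 \<le> K" and "K ^ (r * m) \<le> N"
    and "sqrt (L / ln (L / \<epsilon>)) \<le> 2 * real m * sqrt (real r)"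
    and "sqrt (L / ln (L / \<epsilon>)) * (1 / \<epsilon>\<^sup>2) \<le> real K"
proof -
  define l where "l = ln (L / \<epsilon>)"
  have "exp 1 \<le> L"
    using exp_le L by linarith
  also have "L \<le> L / \<epsilon>"
    using L \<epsilon> by (simp add: le_divide_eq mult_le_cancel_left1)
  finally have "1 \<le> l"
    using L \<epsilon> by (simp add: l_def ln_ge_iff)
  have R': "R * (2 * real m) = L / l"
    using m \<open>1 \<le> l\<close> by (simp add: R_def l_def)
  show r: "0 < r"
    using R by (simp add: r_def)
  have rR: "real r \<le> R" "R \<le> 2 * real r"
  proof -
    have "1 \<le> \<lfloor>R\<rfloor>" "real r = of_int \<lfloor>R\<rfloor>"
      using R by (simp_all add: r_def)
    then show "real r \<le> R" "R \<le> 2 * real r"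
      by linarith+
  qed
  have \<epsilon>2: "0 < \<epsilon>\<^sup>2" "\<epsilon>\<^sup>2 \<le> 1"
    using \<epsilon> by (simp_all add: power_le_one)
  have L\<epsilon>: "L \<le> L / \<epsilon>\<^sup>2"
    using L \<epsilon>2 by (simp add: le_divide_eq mult_le_cancel_left1)
  have K: "L / \<epsilon>\<^sup>2 \<le> real K" "real K \<le> L / \<epsilon>\<^sup>2 + 1"
    using L\<epsilon> L by (simp_all add: K_def)
  show K2: "2 \<le> K"
    using K L\<epsilon> L by linarith
  have "real K \<le> L / \<epsilon>\<^sup>2 + L / \<epsilon>\<^sup>2"
    using K L L\<epsilon> by linarith
  also have "\<dots> = 2 * L / \<epsilon>\<^sup>2" by simp
  \<comment> \<open>One factor L absorbs the 2 that comes from rounding \<open>K\<close> up.\<close>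
  also have "\<dots> \<le> L * L / \<epsilon>\<^sup>2"
    using L by (intro divide_right_mono mult_right_mono) auto
  also have "\<dots> = (L / \<epsilon>)\<^sup>2"
    by (simp add: power2_eq_square)
  finally have "ln (real K) \<le> ln ((L / \<epsilon>)\<^sup>2)"
    using K2 L \<epsilon> by (subst ln_le_cancel_iff) auto
  also have "\<dots> = 2 * l"
    using L \<epsilon> by (simp add: ln_realpow l_def)
  finally have lnK: "ln (real K) \<le> 2 * l" .
  have "ln (real (K ^ (r * m))) = real r * (real m * ln (real K))"
    using K2 by (simp add: ln_realpow)
  also have "\<dots> \<le> R * (real m * (2 * l))"
    using rR lnK \<open>1 \<le> l\<close> K2 by (intro mult_mono) auto
  also have "\<dots> = ln (real N)"
    using R' \<open>1 \<le> l\<close> L by (simp add: field_simps)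
  finally have "real (K ^ (r * m)) \<le> real N"
    using K2 N by (subst (asm) ln_le_cancel_iff) auto
  then show "K ^ (r * m) \<le> N"
    by (simp only: of_nat_le_iff)
  have "1 * sqrt (real m) \<le> sqrt (real m) * sqrt (real m)"
    using m by (intro mult_right_mono) auto
  then have sm: "sqrt (real m) \<le> real m" by simp
  have "L / l = R * (2 * real m)" using R' by simp
  also have "\<dots> \<le> 2 * real r * (2 * real m)"
    using rR by (intro mult_right_mono) auto
  finally have "sqrt (L / l) \<le> sqrt (4 * (real m * real r))"
    by (simp add: mult_ac)
  also have "\<dots> = 2 * sqrt (real m) * sqrt (real r)"
    by (simp add: real_sqrt_mult)
  also have "\<dots> \<le> 2 * real m * sqrt (real r)"
    using sm by (intro mult_right_mono) auto
  finally show "sqrt (L / ln (L / \<epsilon>)) \<le> 2 * real m * sqrt (real r)"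
    by (simp only: l_def)
  have "L / l \<le> L * 1"
    using L \<open>1 \<le> l\<close> by (simp add: divide_le_eq mult_le_cancel_left1)
  also have "\<dots> \<le> L * L"
    using L by (intro mult_left_mono) auto
  finally have "sqrt (L / l) \<le> L"
    using L by (intro real_le_lsqrt) (auto simp: power2_eq_square)
  then have "sqrt (L / l) * (1 / \<epsilon>\<^sup>2) \<le> L / \<epsilon>\<^sup>2"
    using \<epsilon>2 by (simp add: divide_right_mono)
  then show "sqrt (L / ln (L / \<epsilon>)) * (1 / \<epsilon>\<^sup>2) \<le> real K"
    using K by (simp add: l_def)
qed

text \<open>Here L < 2 m ln (L / \<epsilon>), which bounds the target factor directly. Comparison
  with the assumption on ln (2 L) gives 2 L < L / \<epsilon>, so that 2 \<epsilon> is an admissible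
  spike height for two points.\<close>

lemma few_buckets:
  fixes L \<epsilon> :: real and m :: nat
  assumes L: "3 \<le> L" "2 * real m * ln (2 * L) \<le> L" and \<epsilon>: "0 < \<epsilon>" "\<epsilon> < 1" and m: "2 \<le> m"
    and R: "L / (2 * real m * ln (L / \<epsilon>)) < 1"
  shows "\<epsilon> < 1 / 2" and "sqrt (L / ln (L / \<epsilon>)) \<le> 2 * real m"
proof -
  define l where "l = ln (L / \<epsilon>)"
  have "L \<le> L / \<epsilon>"
    using L \<epsilon> by (simp add: le_divide_eq mult_le_cancel_left1)
  then have "1 < L / \<epsilon>"
    using L by linarith
  then have l: "0 < l" by (simp add: l_def)
  have Rl: "L < 2 * real m * l"
    using R l m by (simp add: l_def[symmetric] divide_less_eq split: if_splits)
  then have "2 * real m * ln (2 * L) < 2 * real m * l"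
    using L by linarith
  then have "ln (2 * L) < l"
    using m by simp
  then have "2 * L < L / \<epsilon>"
    using L \<epsilon> by (simp add: l_def)
  then show "\<epsilon> < 1 / 2"
    using L \<epsilon> by (simp add: less_divide_eq field_simps)
  have "L / l \<le> 2 * real m * 1"
    using Rl l by (simp add: divide_le_eq)
  also have "\<dots> \<le> 2 * real m * (2 * real m)"
    using m by (intro mult_left_mono) auto
  finally show "sqrt (L / ln (L / \<epsilon>)) \<le> 2 * real m"
    unfolding l_def by (intro real_le_lsqrt) (auto simp: power2_eq_square)
qed

text \<open>The groups have more than two members because \<open>\<epsilon>\<^sub>0\<close> may be close to 1: selecting one of
  \<open>m\<close> buckets achieves total variation distances up to \<open>1 - 1 / m\<close>. When \<open>\<epsilon>\<close> is so small that not
  even one group of well separated buckets fits into \<open>[N]\<close>, the logarithmic factor is bounded and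
  two points suffice.\<close>

theorem theorem1p5:
  fixes \<epsilon>\<^sub>0 :: real
  assumes "0 < \<epsilon>\<^sub>0" and "\<epsilon>\<^sub>0 < 1"
  shows "\<exists>c::real. c > 0 \<and> (\<exists>N\<^sub>0::nat. \<forall>N\<ge>N\<^sub>0. \<forall>\<epsilon>::real. 0 < \<epsilon> \<and> \<epsilon> \<le> \<epsilon>\<^sub>0 \<longrightarrow>
    (\<exists>Dstar. distribution_on N Dstar \<and>
      (\<forall>null A q. query_bounded N q A \<longrightarrow> identity_tester null N Dstar \<epsilon> A \<longrightarrow>
        real q \<ge> c * (sqrt (ln (real N) / ln (ln (real N) / \<epsilon>)) * (1 / \<epsilon>\<^sup>2)))))"
proof -
  \<comment> \<open>The bound m > 1 / (1 - \<open>\<epsilon>\<^sub>0\<close>) is what makes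
    \<open>\<delta>\<^sub>0 < 1\<close>.\<close>
  obtain m :: nat where m0: "max 2 (1 / (1 - \<epsilon>\<^sub>0)) < real m"
    using reals_Archimedean2 by blast
  then have m: "2 \<le> m" by simp
  define \<delta>\<^sub>0 where "\<delta>\<^sub>0 = \<epsilon>\<^sub>0 * real m / (real m - 1)"
  have "1 / (1 - \<epsilon>\<^sub>0) < real m" using m0 by simp
  then have \<delta>\<^sub>0: "\<delta>\<^sub>0 < 1"
    using assms m by (simp add: \<delta>\<^sub>0_def divide_less_eq algebra_simps)
  \<comment> \<open>The first term defeats the sample alternative, where 8 m^2 c \<le> 1/10 is
    needed, and also covers two points; the second defeats the \<open>Pcond\<close>
    alternative.\<close>
  define c where "c = min (1 / (80 * (real m)\<^sup>2)) ((1 - \<delta>\<^sub>0) / (20 * real m))"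
  have c: "0 < c" "c \<le> 1 / (80 * (real m)\<^sup>2)" "c \<le> (1 - \<delta>\<^sub>0) / (20 * real m)"
    using m \<delta>\<^sub>0 by (simp_all add: c_def)
  have "0 < 2 * real m" using m by simp
  from eventually_ln_ge[OF this] obtain N\<^sub>0 where N\<^sub>0: "\<And>N. N\<^sub>0 \<le> N \<Longrightarrow>
      2 \<le> N \<and> 3 \<le> ln (real N) \<and> 2 * real m * ln (2 * ln (real N)) \<le> ln (real N)"
    unfolding eventually_sequentially by blast
  have "\<exists>Dstar. distribution_on N Dstar \<and>
      (\<forall>null A q. query_bounded N q A \<longrightarrow> identity_tester null N Dstar \<epsilon> A \<longrightarrow>
        real q \<ge> c * (sqrt (ln (real N) / ln (ln (real N) / \<epsilon>)) * (1 / \<epsilon>\<^sup>2)))"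
    if NN: "N\<^sub>0 \<le> N" and \<epsilon>: "0 < \<epsilon>" "\<epsilon> \<le> \<epsilon>\<^sub>0" for N \<epsilon>
  proof -
    define L where "L = ln (real N)"
    define S where "S = sqrt (L / ln (L / \<epsilon>))"
    have N: "2 \<le> N" and L: "3 \<le> L" "2 * real m * ln (2 * L) \<le> L"
      using N\<^sub>0[OF NN] by (simp_all add: L_def)
    have \<epsilon>1: "\<epsilon> < 1" using \<epsilon> assms by simp
    have goal: ?thesis
      if "distribution_on N Dstar"
        and lower: "\<And>null A q. query_bounded N q A \<Longrightarrow> identity_tester null N Dstar \<epsilon> A \<Longrightarrow>
          real q < c * (S * (1 / \<epsilon>\<^sup>2)) \<Longrightarrow> False" for Dstar
      using that unfolding S_def L_def not_less[symmetric] by blast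
    show ?thesis
    proof (cases "1 \<le> L / (2 * real m * ln (L / \<epsilon>))")
      case True
      define r K where "r = nat \<lfloor>L / (2 * real m * ln (L / \<epsilon>))\<rfloor>" and "K = nat \<lceil>L / \<epsilon>\<^sup>2\<rceil>"
      note par = bucket_parameters[OF L(1) L_def \<epsilon>(1) \<epsilon>1 m True N, folded r_def K_def, folded S_def]
      \<comment> \<open>Chosen so that the alternatives lie at distance exactly \<epsilon>; m \<ge>
        2 gives \<delta> \<le> 2 \<epsilon>.\<close>
      define \<delta> where "\<delta> = \<epsilon> * real m / (real m - 1)"
      have "0 < \<delta>" "\<delta> \<le> 2 * \<epsilon>"
        using \<epsilon> m by (auto simp: \<delta>_def field_simps)
      moreover have "\<delta> \<le> \<delta>\<^sub>0"
        using \<epsilon> m unfolding \<delta>_def \<delta>\<^sub>0_def by (intro divide_right_mono mult_right_mono) auto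
      ultimately have \<delta>: "0 < \<delta>" "\<delta> \<le> \<delta>\<^sub>0" "\<delta> \<le> 2 * \<epsilon>" by auto
      have \<delta>\<epsilon>: "\<delta> * (real m - 1) / real m = \<epsilon>"
        using m by (simp add: \<delta>_def)
      have "\<delta> < 1" using \<delta> \<delta>\<^sub>0 by simp
      from geometric_lower_bound[OF par(2,3,1) m \<delta>(1) this, unfolded \<delta>\<epsilon>]
      obtain Dstar where D: "distribution_on N Dstar"
        and lower: "\<And>null A q. query_bounded N q A \<Longrightarrow> identity_tester null N Dstar \<epsilon> A \<Longrightarrow>
          sqrt (real r) / 10 < real q * \<delta>\<^sup>2 * real m \<or> 1 / 20 < real q * (real m / ((1 - \<delta>) * real K))"
        by blast
      show ?thesis
      proof (rule goal[OF D])
        fix null A q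
        assume A: "query_bounded N q A" "identity_tester null N Dstar \<epsilon> A"
          and q: "real q < c * (S * (1 / \<epsilon>\<^sup>2))"
        have "\<delta>\<^sup>2 \<le> (2 * \<epsilon>)\<^sup>2"
          using \<delta> by (intro power_mono) auto
        then have "real q * \<delta>\<^sup>2 * real m \<le> real q * (4 * \<epsilon>\<^sup>2) * real m"
          by (intro mult_right_mono mult_left_mono) (auto simp: power_mult_distrib)
        also have "\<dots> \<le> c * (S * (1 / \<epsilon>\<^sup>2)) * (4 * \<epsilon>\<^sup>2) * real m"
          using q by (intro mult_right_mono) auto
        also have "\<dots> = c * (4 * real m) * S"
          using \<epsilon> by simp
        also have "\<dots> \<le> c * (4 * real m) * (2 * real m * sqrt (real r))"
          using par(4) c by (intro mult_left_mono) auto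
        also have "\<dots> = c * (8 * (real m)\<^sup>2 * sqrt (real r))"
          by (simp add: power2_eq_square)
        also have "\<dots> \<le> 1 / (80 * (real m)\<^sup>2) * (8 * (real m)\<^sup>2 * sqrt (real r))"
          using c by (intro mult_right_mono) auto
        also have "\<dots> = sqrt (real r) / 10"
          using m by simp
        finally have 1: "real q * \<delta>\<^sup>2 * real m \<le> sqrt (real r) / 10" .
        have K: "0 < real K" using par(2) by simp
        have "c * (S * (1 / \<epsilon>\<^sup>2)) \<le> c * real K"
          using par(5) c by (intro mult_left_mono) auto
        also have "\<dots> \<le> (1 - \<delta>\<^sub>0) / (20 * real m) * real K"
          using c by (intro mult_right_mono) auto
        also have "\<dots> \<le> (1 - \<delta>) / (20 * real m) * real K"
          using \<delta> by (intro mult_right_mono divide_right_mono) auto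
        finally have "real q \<le> (1 - \<delta>) / (20 * real m) * real K"
          using q by linarith
        then have "real q * (real m / ((1 - \<delta>) * real K))
            \<le> (1 - \<delta>) / (20 * real m) * real K * (real m / ((1 - \<delta>) * real K))"
          using \<open>\<delta> < 1\<close> by (intro mult_right_mono) auto
        also have "\<dots> = 1 / 20"
          using K m \<open>\<delta> < 1\<close> by simp
        finally show False
          using lower[OF A] 1 by linarith
      qed
    next
      case False
      then have "L / (2 * real m * ln (L / \<epsilon>)) < 1" by simp
      note small = few_buckets[OF L \<epsilon>(1) \<epsilon>1 m this, folded S_def]
      have "0 < 2 * \<epsilon>" "2 * \<epsilon> < 1" using \<epsilon> small(1) by auto
      from two_point_lower_bound[OF N this]
      obtain Dstar where D: "distribution_on N Dstar"
        and lower: "\<And>null A q. query_bounded N q A \<Longrightarrow> identity_tester null N Dstar \<epsilon> A \<Longrightarrow>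
          1 / 20 < real q * (2 * \<epsilon>)\<^sup>2"
        by auto
      show ?thesis
      proof (rule goal[OF D])
        fix null A q
        assume A: "query_bounded N q A" "identity_tester null N Dstar \<epsilon> A"
          and q: "real q < c * (S * (1 / \<epsilon>\<^sup>2))"
        have "real q * (2 * \<epsilon>)\<^sup>2 \<le> c * (S * (1 / \<epsilon>\<^sup>2)) * (2 * \<epsilon>)\<^sup>2"
          using q by (intro mult_right_mono) auto
        also have "\<dots> = c * (4 * S)"
          using \<epsilon> by (simp add: power_mult_distrib)
        also have "\<dots> \<le> c * (4 * (2 * real m))"
          using small(2) c by (intro mult_left_mono) auto
        also have "\<dots> \<le> 1 / (80 * (real m)\<^sup>2) * (4 * (2 * real m))"
          using c by (intro mult_right_mono) auto
        also have "\<dots> \<le> 1 / 20"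
          using m by (simp add: power2_eq_square field_simps)
        finally show False
          using lower[OF A] by linarith
      qed
    qed
  qed
  then show ?thesis
    using c(1) by blast
qed

end
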